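(* Let $N\in\mathbb{N}$ and $G=\mathbb{Z}^N$. Let $(A_i)_{i\in\mathbb{N}}$ be a sequence of $N\times N$ real matrices with all entries in $(-\pi,\pi]$, and let $(m_i)_{i\in\mathbb{N}}$ be a sequence in $\mathbb{N}$. For each $i\in\mathbb{N}$ set $F_i=\{0,1,\ldots,m_i\}^N\subset G$, $\phi_i=\frac{1}{(\#F_i)^{1/2}}\chi_{F_i}\in\ell^2(G)$ (with $\chi_{F_i}$ the characteristic function of $F_i$), and $u_i=u_{A_i}\in Z^2(G,\mathbb{T})$, where $u_A(x,y)=e^{ix\cdot(Ay)}$ for $x,y\in G$. Then: (1) $(F_i)$ is an $F$-sequence for $G$ if and only if $m_i\to+\infty$. (2) $(F_i)$ is a $\sigma F$-sequence for $G$ if and only if $\sum_{i=1}^\infty\frac{1}{m_i}<\infty$. (3) $\prod_iu_i$ exists (pointwise on $G\times G$) if and only if $\sum_i|A_i|_\infty<\infty$. (4) The projective unitary representation $\otimes_i\lambda_{u_i}$ of $G$ exists on $\bigotimes_i^{\phi}\ell^2(G)$, $\phi=(\phi_i)$, whenever $\sum_{i=1}^\infty\frac{1}{m_i}<\infty$ and $\sum_{i=1}^\infty m_i|A_i|_\infty<\infty$ (and $\prod_iu_i$ is then the associated 2-cocycle).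
   Context: $\mathbb{N}=\{1,2,\ldots\}$. For a matrix $A=(a_{kl})$, $|A|_\infty=\max_{k,l}|a_{kl}|$. $Z^2(G,\mathbb{T})$ is the set of normalized 2-cocycles $u:G\times G\to\mathbb{T}$ (circle group): $u(x,y)u(x+y,z)=u(y,z)u(x,y+z)$, $u(x,0)=u(0,x)=1$. For $u\in Z^2(G,\mathbb{T})$, $\lambda_u$ is the projective unitary representation of $G$ on $\ell^2(G)$ given by $(\lambda_u(x)f)(y)=u(-y,x)f(y-x)$; a projective unitary representation $U$ with associated 2-cocycle $u$ satisfies $U(x)U(y)=u(x,y)U(x+y)$. An infinite product $\prod_iz_i$ of complex numbers exists if the net of finite products $\prod_{i\in J}z_i$, indexed by the finite non-empty $J\subset\mathbb{N}$ ordered by inclusion, converges. A sequence $(F_i)$ of non-empty finite subsets of $G$ is an $F$-sequence if $\lim_i\frac{\#(F_i\cap(x+F_i))}{\#F_i}=1$ for all $x\in G$, and a $\sigma F$-sequence if $\sum_i\left|1-\frac{\#(F_i\cap(x+F_i))}{\#F_i}\right|<\infty$ for all $x\in G$. Infinite tensor products: for Hilbert spaces $\mathcal{H}_i$ and unit vectors $\phi_i\in\mathcal{H}_i$, $\phi=(\phi_i)$, the space $\mathcal{H}^\phi=\bigotimes_i^{\phi}\mathcal{H}_i$ is the completed inductive limit of the spaces $\mathcal{H}_1\otimes\cdots\otimes\mathcal{H}_n$ under the isometries $\psi\mapsto\psi\otimes\phi_{n+1}$. For bounded operators $T_i$ on $\mathcal{H}_i$ and a finite non-empty $J\subset\mathbb{N}$,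 let $\tilde T_J$ be the bounded operator on $\mathcal{H}^\phi$ acting as $T_i$ in the factors $i\in J$ and as the identity in the others. One says that $\otimes_iT_i$ exists on $\mathcal{H}^\phi$ if the net $(\tilde T_J)_J$ (indexed by finite non-empty subsets of $\mathbb{N}$ ordered by inclusion) converges in the strong operator topology to a bounded operator, which is then denoted $\otimes_iT_i$. "$\otimes_i\lambda_{u_i}$ exists" means $\otimes_i\lambda_{u_i}(x)$ exists for every $x\in G$. *)

theory Defs
  imports "HOL-Analysis.Analysis"
begin

section \<open>Folner-type sequences, cocycles and infinite products\<close>

definition overlap :: "'g::ab_group_add set \<Rightarrow> 'g \<Rightarrow> real" where
  "overlap F x = real (card (F \<inter> (+) x ` F)) / real (card F)"

definition F_sequence :: "(nat \<Rightarrow> 'g::ab_group_add set) \<Rightarrow> bool" where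
  "F_sequence F \<longleftrightarrow>
     (\<forall>i. finite (F i) \<and> F i \<noteq> {}) \<and> (\<forall>x. (\<lambda>i. overlap (F i) x) \<longlonglongrightarrow> 1)"

definition sigmaF_sequence :: "(nat \<Rightarrow> 'g::ab_group_add set) \<Rightarrow> bool" where
  "sigmaF_sequence F \<longleftrightarrow>
     (\<forall>i. finite (F i) \<and> F i \<noteq> {}) \<and> (\<forall>x. summable (\<lambda>i. \<bar>1 - overlap (F i) x\<bar>))"

definition cocycles :: "('g::ab_group_add \<Rightarrow> 'g \<Rightarrow> complex) set" where
  "cocycles = {u. (\<forall>x y. cmod (u x y) = 1)
      \<and> (\<forall>x y z. u x y * u (x + y) z = u y z * u x (y + z))
      \<and> (\<forall>x. u x 0 = 1 \<and> u 0 x = 1)}"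

definition regular_rep ::
  "('g::ab_group_add \<Rightarrow> 'g \<Rightarrow> complex) \<Rightarrow> 'g \<Rightarrow> ('g \<Rightarrow> complex) \<Rightarrow> 'g \<Rightarrow> complex" where
  "regular_rep u x f = (\<lambda>y. u (- y) x * f (y - x))"

text \<open>The filter \<^term>\<open>finite_subsets_at_top UNIV\<close> also involves the empty index set, which
  has no influence on convergence along it.\<close>

definition infprod_exists :: "(nat \<Rightarrow> complex) \<Rightarrow> bool" where
  "infprod_exists z \<longleftrightarrow> (\<exists>p. ((\<lambda>J. \<Prod>i\<in>J. z i) \<longlongrightarrow> p) (finite_subsets_at_top UNIV))"

definition infprod :: "(nat \<Rightarrow> complex) \<Rightarrow> complex" where
  "infprod z = Lim (finite_subsets_at_top UNIV) (\<lambda>J. \<Prod>i\<in>J. z i)"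


section \<open>Complex inner product spaces with explicit carrier\<close>

text \<open>The Hilbert space structure of an infinite tensor product depends on the reference
  vectors, so spaces are records with a carrier rather than instances of a type class.\<close>

record 'v inner_space =
  vecs :: "'v set"
  vadd :: "'v \<Rightarrow> 'v \<Rightarrow> 'v"
  vscale :: "complex \<Rightarrow> 'v \<Rightarrow> 'v"
  vinner :: "'v \<Rightarrow> 'v \<Rightarrow> complex"

definition vnorm :: "'v inner_space \<Rightarrow> 'v \<Rightarrow> real" where
  "vnorm H v = sqrt (Re (vinner H v v))"

definition vdist :: "'v inner_space \<Rightarrow> 'v \<Rightarrow> 'v \<Rightarrow> real" where
  "vdist H v w = vnorm H (vadd H v (vscale H (- 1) w))"

definition bounded_operator :: "'v inner_space \<Rightarrow> ('v \<Rightarrow> 'v) \<Rightarrow> bool" where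
  "bounded_operator H S \<longleftrightarrow>
     (\<forall>v\<in>vecs H. S v \<in> vecs H)
   \<and> (\<forall>v\<in>vecs H. \<forall>w\<in>vecs H. S (vadd H v w) = vadd H (S v) (S w))
   \<and> (\<forall>c. \<forall>v\<in>vecs H. S (vscale H c v) = vscale H c (S v))
   \<and> (\<exists>B. \<forall>v\<in>vecs H. vnorm H (S v) \<le> B * vnorm H v)"

definition unitary_operator :: "'v inner_space \<Rightarrow> ('v \<Rightarrow> 'v) \<Rightarrow> bool" where
  "unitary_operator H S \<longleftrightarrow> bounded_operator H S \<and> S ` vecs H = vecs H
   \<and> (\<forall>v\<in>vecs H. \<forall>w\<in>vecs H. vinner H (S v) (S w) = vinner H v w)"

definition strong_limit ::
  "'v inner_space \<Rightarrow> ('j \<Rightarrow> 'v \<Rightarrow> 'v) \<Rightarrow> ('v \<Rightarrow> 'v) \<Rightarrow> 'j filter \<Rightarrow> bool" where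
  "strong_limit H T S \<F> \<longleftrightarrow> (\<forall>v\<in>vecs H. ((\<lambda>j. vdist H (T j v) (S v)) \<longlongrightarrow> 0) \<F>)"

definition projective_unitary_rep ::
  "'v inner_space \<Rightarrow> ('g::ab_group_add \<Rightarrow> 'v \<Rightarrow> 'v) \<Rightarrow> ('g \<Rightarrow> 'g \<Rightarrow> complex) \<Rightarrow> bool" where
  "projective_unitary_rep H U u \<longleftrightarrow> u \<in> cocycles \<and> (\<forall>x. unitary_operator H (U x))
   \<and> (\<forall>x y. \<forall>v\<in>vecs H. U x (U y v) = vscale H (u x y) (U (x + y) v))"

definition ell2 :: "'a set \<Rightarrow> ('a \<Rightarrow> complex) inner_space" where
  "ell2 X = \<lparr> vecs = {f. (\<forall>x. x \<notin> X \<longrightarrow> f x = 0) \<and> (\<lambda>x. (cmod (f x))\<^sup>2) summable_on UNIV},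
     vadd = (\<lambda>f g x. f x + g x),
     vscale = (\<lambda>c f x. c * f x),
     vinner = (\<lambda>f g. \<Sum>\<^sub>\<infinity>x. f x * cnj (g x)) \<rparr>"


section \<open>Completed inductive limits\<close>

text \<open>\<open>H 0 \<rightarrow> H 1 \<rightarrow> \<dots>\<close> is a system of Hilbert spaces with isometries \<open>\<iota> n : H n \<rightarrow> H (n + 1)\<close>,
  and \<open>connect \<iota> n d\<close> is the composite isometry from \<open>H n\<close> to \<open>H (n + d)\<close>.\<close>

primrec connect :: "(nat \<Rightarrow> 'v \<Rightarrow> 'v) \<Rightarrow> nat \<Rightarrow> nat \<Rightarrow> 'v \<Rightarrow> 'v" where
  "connect \<iota> n 0 v = v"
| "connect \<iota> n (Suc d) v = \<iota> (n + d) (connect \<iota> n d v)"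

text \<open>The algebraic inductive limit is the union of the \<open>H n\<close>, where \<open>v\<close> in \<open>H n\<close> is identified
  with all its images \<open>connect \<iota> n d v\<close>. Its completion consists of Cauchy sequences modulo
  null sequences. By repeating terms, every Cauchy sequence in the union is equivalent to one whose
  \<open>k\<close>-th term lies in \<open>H k\<close>, and only such sequences are used. A vector \<open>v\<close> in \<open>H n\<close> corresponds to
  the class of any sequence with \<open>n + d\<close>-th term \<open>connect \<iota> n d v\<close> for all \<open>d\<close>.\<close>

definition limit_seqs ::
  "(nat \<Rightarrow> 'v inner_space) \<Rightarrow> (nat \<Rightarrow> 'v \<Rightarrow> 'v) \<Rightarrow> (nat \<Rightarrow> 'v) set" where
  "limit_seqs H \<iota> = {s. (\<forall>k. s k \<in> vecs (H k))
     \<and> (\<forall>e>0. \<exists>M. \<forall>n\<ge>M. \<forall>d. vdist (H (n + d)) (connect \<iota> n d (s n)) (s (n + d)) < e)}"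

definition limit_rel ::
  "(nat \<Rightarrow> 'v inner_space) \<Rightarrow> (nat \<Rightarrow> 'v \<Rightarrow> 'v) \<Rightarrow> ((nat \<Rightarrow> 'v) \<times> (nat \<Rightarrow> 'v)) set" where
  "limit_rel H \<iota> = {(s, t). s \<in> limit_seqs H \<iota> \<and> t \<in> limit_seqs H \<iota>
     \<and> (\<lambda>k. vdist (H k) (s k) (t k)) \<longlonglongrightarrow> 0}"

definition rep :: "(nat \<Rightarrow> 'v) set \<Rightarrow> nat \<Rightarrow> 'v" where
  "rep v = (SOME s. s \<in> v)"

definition completed_limit ::
  "(nat \<Rightarrow> 'v inner_space) \<Rightarrow> (nat \<Rightarrow> 'v \<Rightarrow> 'v) \<Rightarrow> (nat \<Rightarrow> 'v) set inner_space" where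
  "completed_limit H \<iota> = \<lparr> vecs = limit_seqs H \<iota> // limit_rel H \<iota>,
     vadd = (\<lambda>v w. limit_rel H \<iota> `` {\<lambda>k. vadd (H k) (rep v k) (rep w k)}),
     vscale = (\<lambda>c v. limit_rel H \<iota> `` {\<lambda>k. vscale (H k) c (rep v k)}),
     vinner = (\<lambda>v w. lim (\<lambda>k. vinner (H k) (rep v k) (rep w k))) \<rparr>"

text \<open>The operator on the completed limit given by operators \<open>T k\<close> on \<open>H k\<close> which are uniformly
  bounded and, for large \<open>k\<close>, intertwined by \<open>\<iota>\<close>.\<close>

definition limit_op ::
  "(nat \<Rightarrow> 'v inner_space) \<Rightarrow> (nat \<Rightarrow> 'v \<Rightarrow> 'v) \<Rightarrow> (nat \<Rightarrow> 'v \<Rightarrow> 'v)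
    \<Rightarrow> (nat \<Rightarrow> 'v) set \<Rightarrow> (nat \<Rightarrow> 'v) set" where
  "limit_op H \<iota> T v = limit_rel H \<iota> `` {\<lambda>k. T k (rep v k)}"


section \<open>Infinite tensor products of copies of \<open>\<ell>\<^sup>2\<close>\<close>

text \<open>The tensor product of \<open>n\<close> copies of the \<open>\<ell>\<^sup>2\<close>-space of \<open>'a\<close> is the \<open>\<ell>\<^sup>2\<close>-space of the set of
  lists of length \<open>n\<close>, the elementary tensor of \<open>f\<^sub>0, \<dots>, f\<^sub>n\<^sub>-\<^sub>1\<close> being the function
  \<open>xs \<mapsto> f\<^sub>0 (xs ! 0) \<cdots> f\<^sub>n\<^sub>-\<^sub>1 (xs ! (n - 1))\<close>. Factors are numbered from 0.\<close>

definition tensor_power :: "nat \<Rightarrow> ('a list \<Rightarrow> complex) inner_space" where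
  "tensor_power n = ell2 {xs. length xs = n}"

definition append_factor :: "('a list \<Rightarrow> complex) \<Rightarrow> ('a \<Rightarrow> complex) \<Rightarrow> 'a list \<Rightarrow> complex" where
  "append_factor \<psi> f = (\<lambda>xs. if xs = [] then 0 else \<psi> (butlast xs) * f (last xs))"

definition inf_tensor ::
  "(nat \<Rightarrow> 'a \<Rightarrow> complex) \<Rightarrow> (nat \<Rightarrow> 'a list \<Rightarrow> complex) set inner_space" where
  "inf_tensor \<phi> = completed_limit tensor_power (\<lambda>n \<psi>. append_factor \<psi> (\<phi> n))"

text \<open>\<open>T\<close> acting in the \<open>i\<close>-th factor, i.e. on \<open>\<psi>\<close> as a function of its \<open>i\<close>-th variable alone;
  the identity if there is no such factor.\<close>

definition in_factor ::
  "nat \<Rightarrow> (('a \<Rightarrow> complex) \<Rightarrow> 'a \<Rightarrow> complex) \<Rightarrow> ('a list \<Rightarrow> complex) \<Rightarrow> 'a list \<Rightarrow> complex" where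
  "in_factor i T \<psi> =
     (\<lambda>xs. if i < length xs then T (\<lambda>a. \<psi> (xs[i := a])) (xs ! i) else \<psi> xs)"

definition in_factors ::
  "(nat \<Rightarrow> ('a \<Rightarrow> complex) \<Rightarrow> 'a \<Rightarrow> complex) \<Rightarrow> nat set
    \<Rightarrow> ('a list \<Rightarrow> complex) \<Rightarrow> 'a list \<Rightarrow> complex" where
  "in_factors T J = foldr (\<lambda>i. in_factor i (T i)) (sorted_list_of_set J)"

definition partial_tensor_op ::
  "(nat \<Rightarrow> 'a \<Rightarrow> complex) \<Rightarrow> (nat \<Rightarrow> ('a \<Rightarrow> complex) \<Rightarrow> 'a \<Rightarrow> complex) \<Rightarrow> nat set
    \<Rightarrow> (nat \<Rightarrow> 'a list \<Rightarrow> complex) set \<Rightarrow> (nat \<Rightarrow> 'a list \<Rightarrow> complex) set" where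
  "partial_tensor_op \<phi> T J =
     limit_op tensor_power (\<lambda>n \<psi>. append_factor \<psi> (\<phi> n)) (\<lambda>k. in_factors T J)"

definition is_tensor_op ::
  "(nat \<Rightarrow> 'a \<Rightarrow> complex) \<Rightarrow> (nat \<Rightarrow> ('a \<Rightarrow> complex) \<Rightarrow> 'a \<Rightarrow> complex)
    \<Rightarrow> ((nat \<Rightarrow> 'a list \<Rightarrow> complex) set \<Rightarrow> (nat \<Rightarrow> 'a list \<Rightarrow> complex) set) \<Rightarrow> bool" where
  "is_tensor_op \<phi> T S \<longleftrightarrow> bounded_operator (inf_tensor \<phi>) S
     \<and> strong_limit (inf_tensor \<phi>) (partial_tensor_op \<phi> T) S (finite_subsets_at_top UNIV)"

definition tensor_op_exists ::
  "(nat \<Rightarrow> 'a \<Rightarrow> complex) \<Rightarrow> (nat \<Rightarrow> ('a \<Rightarrow> complex) \<Rightarrow> 'a \<Rightarrow> complex) \<Rightarrow> bool" where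
  "tensor_op_exists \<phi> T \<longleftrightarrow> (\<exists>S. is_tensor_op \<phi> T S)"

text \<open>The choice below is unique on the carrier of \<^term>\<open>inf_tensor \<phi>\<close>; values elsewhere are
  irrelevant.\<close>

definition tensor_op ::
  "(nat \<Rightarrow> 'a \<Rightarrow> complex) \<Rightarrow> (nat \<Rightarrow> ('a \<Rightarrow> complex) \<Rightarrow> 'a \<Rightarrow> complex)
    \<Rightarrow> (nat \<Rightarrow> 'a list \<Rightarrow> complex) set \<Rightarrow> (nat \<Rightarrow> 'a list \<Rightarrow> complex) set" where
  "tensor_op \<phi> T = (SOME S. is_tensor_op \<phi> T S)"


section \<open>The data on \<open>\<int>\<^sup>N\<close>\<close>

definition real_vec :: "int ^ 'n \<Rightarrow> real ^ 'n" where
  "real_vec x = (\<chi> j. real_of_int (x $ j))"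

definition u_mat :: "real ^ 'n ^ 'n \<Rightarrow> int ^ 'n \<Rightarrow> int ^ 'n \<Rightarrow> complex" where
  "u_mat A x y = exp (\<i> * complex_of_real (real_vec x \<bullet> (A *v real_vec y)))"

definition max_entry :: "real ^ 'n ^ 'n \<Rightarrow> real" where
  "max_entry A = Max (range (\<lambda>(k, l). \<bar>A $ k $ l\<bar>))"

lemma real_vec_add: "real_vec (x + y) = real_vec x + real_vec y"
  by (simp add: real_vec_def vec_eq_iff)

lemma real_vec_0 [simp]: "real_vec 0 = 0"
  by (simp add: real_vec_def vec_eq_iff)

lemma u_mat_cocycle: "u_mat A \<in> cocycles"
  by (auto simp: cocycles_def u_mat_def real_vec_add matrix_vector_right_distrib inner_add
      algebra_simps simp flip: exp_add)

lemma regular_rep_compose: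
  assumes "u \<in> cocycles"
  shows "regular_rep u x (regular_rep u y f) = (\<lambda>z. u x y * regular_rep u (x + y) f z)"
proof
  fix z
  have "u (- z) x * u (- z + x) y = u x y * u (- z) (x + y)"
    using assms unfolding cocycles_def by blast
  then show "regular_rep u x (regular_rep u y f) z = u x y * regular_rep u (x + y) f z"
    by (simp add: regular_rep_def algebra_simps)
qed

end

theory Submission
  imports Defs
begin

text \<open>The products converge exactly when the phases are absolutely summable: if all finite
  products of the remaining terms stay close to 1, then sums of phases in \<open>(-\<pi>, \<pi>]\<close> of one sign grow
  in steps too small to wind around the circle.

  For the representation, every \<open>\<lambda>\<^bsub>u\<^sub>i\<^esub>(x)\<close> is a translation times a function of modulus 1, so tensor
  products of such operators over any set of indices are explicit isometries on functions of
  lists. Whether the tensor product converges is decided by the numbers \<open>z\<^sub>i = \<langle>\<lambda>\<^bsub>u\<^sub>i\<^esub>(x)\<phi>\<^sub>i, \<phi>\<^sub>i\<rangle>\<close>: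
  two such operators that agree on the first \<open>n\<close> factors differ on \<open>\<psi> \<otimes> \<phi>\<^sub>n \<otimes> \<phi>\<^bsub>n+1\<^esub> \<otimes> \<dots>\<close> by at most
  \<open>\<parallel>\<psi>\<parallel> (2 \<Sum>\<^bsub>i\<ge>n\<^esub> |1 - z\<^sub>i|)\<^bsup>1/2\<^esup>\<close>. For the cubes, \<open>|1 - z\<^sub>i|\<close> is bounded by a multiple of
  \<open>1/m\<^sub>i + m\<^sub>i|A\<^sub>i|\<^sub>\<infinity>\<close>. The limit operator is obtained by applying the translations in all factors
  simultaneously to representing Cauchy sequences, so completeness is never needed.\<close>

section \<open>Square-summable functions\<close>

text \<open>Support in \<open>X\<close> affects neither the norm nor the inner product of
  \<open>ell2 X\<close>, so both are studied first for functions on the whole type, with no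
  carrier.\<close>

definition square_summable :: "('a \<Rightarrow> complex) \<Rightarrow> bool" where
  "square_summable f \<longleftrightarrow> (\<lambda>x. (cmod (f x))\<^sup>2) summable_on UNIV"

definition l2_inner :: "('a \<Rightarrow> complex) \<Rightarrow> ('a \<Rightarrow> complex) \<Rightarrow> complex" where
  "l2_inner f g = (\<Sum>\<^sub>\<infinity>x. f x * cnj (g x))"

definition l2_norm :: "('a \<Rightarrow> complex) \<Rightarrow> real" where
  "l2_norm f = sqrt (\<Sum>\<^sub>\<infinity>x. (cmod (f x))\<^sup>2)"

lemma l2_norm_nonneg [simp]: "0 \<le> l2_norm f"
  by (simp add: l2_norm_def infsum_nonneg)

lemma l2_norm_power2: "(l2_norm f)\<^sup>2 = (\<Sum>\<^sub>\<infinity>x. (cmod (f x))\<^sup>2)"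
  by (simp add: l2_norm_def infsum_nonneg)

lemma square_summable_zero [simp]: "square_summable (\<lambda>x. 0)"
  by (simp add: square_summable_def)

lemma l2_norm_zero [simp]: "l2_norm (\<lambda>x. 0) = 0"
  by (simp add: l2_norm_def)

lemma L2_set_le_l2_norm:
  assumes "square_summable f" "finite A"
  shows "L2_set (\<lambda>x. cmod (f x)) A \<le> l2_norm f"
  using assms unfolding L2_set_def l2_norm_def square_summable_def
  by (intro real_sqrt_le_mono finite_sum_le_infsum) auto

text \<open>Carries Minkowski's inequality over from finite sets, where it is known for
  \<open>L2_set\<close>; the empty set shows that the bound is nonnegative.\<close>

lemma square_summable_bounded:
  assumes "\<And>A. finite A \<Longrightarrow> L2_set (\<lambda>x. cmod (f x)) A \<le> B"
  shows "square_summable f" and "l2_norm f \<le> B"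
proof -
  have B: "(\<Sum>x\<in>A. (cmod (f x))\<^sup>2) \<le> B\<^sup>2" if "finite A" for A
    using power_mono[OF assms[OF that], of 2]
    by (simp add: L2_set_def sum_nonneg)
  have nn: "0 \<le> B"
    using assms[of "{}"] by simp
  show s: "square_summable f"
    unfolding square_summable_def
    by (rule nonneg_bdd_above_summable_on) (use B in \<open>auto intro!: bdd_aboveI2[of _ _ "B\<^sup>2"]\<close>)
  have "(\<Sum>\<^sub>\<infinity>x. (cmod (f x))\<^sup>2) \<le> B\<^sup>2"
    using s B unfolding square_summable_def by (intro infsum_le_finite_sums) auto
  then show "l2_norm f \<le> B"
    unfolding l2_norm_def using nn by (simp add: real_le_lsqrt infsum_nonneg)
qed

lemma
  assumes f: "square_summable f" and g: "square_summable g"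
  shows square_summable_add [intro]: "square_summable (\<lambda>x. f x + g x)"
    and l2_norm_triangle: "l2_norm (\<lambda>x. f x + g x) \<le> l2_norm f + l2_norm g"
proof -
  have "L2_set (\<lambda>x. cmod (f x + g x)) A \<le> l2_norm f + l2_norm g" if A: "finite A" for A
  proof -
    have "L2_set (\<lambda>x. cmod (f x + g x)) A \<le> L2_set (\<lambda>x. cmod (f x) + cmod (g x)) A"
      by (intro L2_set_mono norm_triangle_ineq) auto
    also have "\<dots> \<le> L2_set (\<lambda>x. cmod (f x)) A + L2_set (\<lambda>x. cmod (g x)) A"
      by (rule L2_set_triangle_ineq)
    also have "\<dots> \<le> l2_norm f + l2_norm g"
      by (intro add_mono L2_set_le_l2_norm f g A)
    finally show ?thesis .
  qed
  from square_summable_bounded[OF this] show "square_summable (\<lambda>x. f x + g x)"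
    and "l2_norm (\<lambda>x. f x + g x) \<le> l2_norm f + l2_norm g"
    by auto
qed

lemma square_summable_scale [intro]:
  assumes "square_summable f"
  shows "square_summable (\<lambda>x. c * f x)"
  using assms by (simp add: square_summable_def norm_mult power_mult_distrib summable_on_cmult_right)

lemma l2_norm_scale: "l2_norm (\<lambda>x. c * f x) = cmod c * l2_norm f"
  by (simp add: l2_norm_def norm_mult power_mult_distrib infsum_cmult_right' real_sqrt_mult)

lemma square_summable_diff [intro]:
  assumes "square_summable f" "square_summable g"
  shows "square_summable (\<lambda>x. f x - g x)"
  using square_summable_add[OF assms(1) square_summable_scale[OF assms(2), of "- 1"]] by simp

lemma l2_norm_minus_commute: "l2_norm (\<lambda>x. f x - g x) = l2_norm (\<lambda>x. g x - f x)"
  by (simp add: l2_norm_def norm_minus_commute)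

lemma l2_norm_triangle3:
  assumes "square_summable f" "square_summable g" "square_summable h"
  shows "l2_norm (\<lambda>x. f x - h x) \<le> l2_norm (\<lambda>x. f x - g x) + l2_norm (\<lambda>x. g x - h x)"
  using l2_norm_triangle[of "\<lambda>x. f x - g x" "\<lambda>x. g x - h x"] assms by auto

lemma l2_norm_triangle_diff:
  assumes "square_summable f" "square_summable g"
  shows "l2_norm f \<le> l2_norm (\<lambda>x. f x - g x) + l2_norm g"
  using l2_norm_triangle3[of f g "\<lambda>x. 0"] assms by auto

lemma
  assumes f: "square_summable f" and g: "square_summable g"
  shows l2_inner_abs_summable: "(\<lambda>x. cmod (f x * cnj (g x))) summable_on UNIV"
    and Cauchy_Schwarz_l2: "cmod (l2_inner f g) \<le> l2_norm f * l2_norm g"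
proof -
  have *: "(\<Sum>x\<in>A. cmod (f x * cnj (g x))) \<le> l2_norm f * l2_norm g" if A: "finite A" for A
  proof -
    have "(\<Sum>x\<in>A. cmod (f x * cnj (g x))) \<le> L2_set (\<lambda>x. cmod (f x)) A * L2_set (\<lambda>x. cmod (g x)) A"
      using L2_set_mult_ineq[of "\<lambda>x. cmod (f x)" "\<lambda>x. cmod (g x)" A] by (simp add: norm_mult)
    also have "\<dots> \<le> l2_norm f * l2_norm g"
      by (intro mult_mono L2_set_le_l2_norm f g A) auto
    finally show ?thesis .
  qed
  show s: "(\<lambda>x. cmod (f x * cnj (g x))) summable_on UNIV"
    by (rule nonneg_bdd_above_summable_on)
      (use * in \<open>auto intro!: bdd_aboveI2[of _ _ "l2_norm f * l2_norm g"]\<close>)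
  have "cmod (l2_inner f g) \<le> (\<Sum>\<^sub>\<infinity>x. cmod (f x * cnj (g x)))"
    unfolding l2_inner_def by (rule norm_infsum_bound[OF s])
  also have "\<dots> \<le> l2_norm f * l2_norm g"
    by (rule infsum_le_finite_sums[OF s]) (use * in auto)
  finally show "cmod (l2_inner f g) \<le> l2_norm f * l2_norm g" .
qed

lemma l2_inner_summable:
  assumes "square_summable f" "square_summable g"
  shows "(\<lambda>x. f x * cnj (g x)) summable_on UNIV"
  using l2_inner_abs_summable[OF assms] by (rule abs_summable_summable)

lemma l2_inner_has_sum:
  assumes "square_summable f" "square_summable g"
  shows "((\<lambda>x. f x * cnj (g x)) has_sum l2_inner f g) UNIV"
  using l2_inner_summable[OF assms] by (simp add: l2_inner_def)

text \<open>For complex families summability and absolute summability agree. This form lets square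
  summability be read off a \<open>has_sum\<close> statement about an inner product.\<close>

lemma square_summable_iff_summable: "square_summable f \<longleftrightarrow> (\<lambda>x. f x * cnj (f x)) summable_on UNIV"
  by (simp add: square_summable_def summable_on_iff_abs_summable_on_complex norm_mult power2_eq_square)

text \<open>Holds for every function: if it is not square summable, both infinite sums take the
  default value 0.\<close>

lemma l2_inner_self: "l2_inner f f = complex_of_real ((l2_norm f)\<^sup>2)"
proof -
  have "(\<lambda>x. f x * cnj (f x)) = (\<lambda>x. complex_of_real ((cmod (f x))\<^sup>2))"
    by (simp add: complex_norm_square[symmetric])
  moreover have "(\<Sum>\<^sub>\<infinity>x. complex_of_real ((cmod (f x))\<^sup>2)) = complex_of_real (\<Sum>\<^sub>\<infinity>x. (cmod (f x))\<^sup>2)"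
  proof (cases "square_summable f")
    case True
    then show ?thesis
      unfolding square_summable_def by (intro infsumI has_sum_of_real has_sum_infsum)
  next
    case False
    then have "\<not> (\<lambda>x. complex_of_real ((cmod (f x))\<^sup>2)) summable_on UNIV"
      by (simp add: square_summable_def summable_on_iff_abs_summable_on_complex norm_power)
    with False show ?thesis
      by (simp add: infsum_not_exists square_summable_def)
  qed
  ultimately show ?thesis
    by (simp add: l2_inner_def l2_norm_power2)
qed

lemma l2_inner_add_left:
  assumes "square_summable f" "square_summable g" "square_summable h"
  shows "l2_inner (\<lambda>x. f x + g x) h = l2_inner f h + l2_inner g h"
  unfolding l2_inner_def
  using infsum_add[OF l2_inner_summable l2_inner_summable, OF assms(1,3) assms(2,3)]
  by (simp add: distrib_right)

lemma l2_inner_scale_left: "l2_inner (\<lambda>x. c * f x) g = c * l2_inner f g"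
  by (simp add: l2_inner_def mult.assoc infsum_cmult_right')

lemma l2_inner_commute: "l2_inner f g = cnj (l2_inner g f)"
  unfolding l2_inner_def by (subst infsum_cnj[symmetric]) (simp add: mult.commute)

lemma l2_inner_diff_left:
  assumes "square_summable f" "square_summable g" "square_summable h"
  shows "l2_inner (\<lambda>x. f x - g x) h = l2_inner f h - l2_inner g h"
  using l2_inner_add_left[OF assms(1) square_summable_scale[OF assms(2), of "- 1"] assms(3)]
  by (simp add: l2_inner_scale_left[of "- 1", simplified])

lemma l2_inner_diff_right:
  assumes "square_summable f" "square_summable g" "square_summable h"
  shows "l2_inner h (\<lambda>x. f x - g x) = l2_inner h f - l2_inner h g"
  using l2_inner_diff_left[OF assms] by (metis complex_cnj_diff l2_inner_commute)

text \<open>Change one argument at a time and apply the Cauchy-Schwarz inequality to each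
  difference.\<close>

lemma l2_inner_diff_le:
  assumes "square_summable f" "square_summable f'" "square_summable g" "square_summable g'"
  shows "cmod (l2_inner f g - l2_inner f' g')
    \<le> l2_norm (\<lambda>x. f x - f' x) * l2_norm g + l2_norm f' * l2_norm (\<lambda>x. g x - g' x)"
proof -
  have "l2_inner f g - l2_inner f' g' = l2_inner (\<lambda>x. f x - f' x) g + l2_inner f' (\<lambda>x. g x - g' x)"
    using assms by (simp add: l2_inner_diff_left l2_inner_diff_right)
  then have "cmod (l2_inner f g - l2_inner f' g')
      \<le> cmod (l2_inner (\<lambda>x. f x - f' x) g) + cmod (l2_inner f' (\<lambda>x. g x - g' x))"
    by (simp add: norm_triangle_ineq)
  also have "\<dots> \<le> l2_norm (\<lambda>x. f x - f' x) * l2_norm g + l2_norm f' * l2_norm (\<lambda>x. g x - g' x)"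
    using assms by (intro add_mono Cauchy_Schwarz_l2 square_summable_diff)
  finally show ?thesis .
qed

text \<open>Reduces the distance between two isometric images of a vector to the real part of an
  inner product, which factorizes over tensor factors.\<close>

lemma l2_norm_diff_power2:
  assumes f: "square_summable f" and g: "square_summable g"
  shows "(l2_norm (\<lambda>x. f x - g x))\<^sup>2 = (l2_norm f)\<^sup>2 + (l2_norm g)\<^sup>2 - 2 * Re (l2_inner f g)"
proof -
  have "l2_inner (\<lambda>x. f x - g x) (\<lambda>x. f x - g x)
      = l2_inner f f - l2_inner f g - (l2_inner g f - l2_inner g g)"
    using f g by (simp add: l2_inner_diff_left l2_inner_diff_right square_summable_diff)
  moreover have "Re (l2_inner g f) = Re (l2_inner f g)"
    by (subst l2_inner_commute) simp
  ultimately show ?thesis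
    unfolding l2_inner_self[of "\<lambda>x. f x - g x"]
    by (simp add: l2_inner_self complex_eq_iff)
qed

section \<open>The spaces \<open>ell2 X\<close> as records\<close>

lemma vecs_ell2: "vecs (ell2 X) = {f. (\<forall>x. x \<notin> X \<longrightarrow> f x = 0) \<and> square_summable f}"
  by (simp add: ell2_def square_summable_def)

lemma ell2_simps [simp]:
  "vadd (ell2 X) f g = (\<lambda>x. f x + g x)"
  "vscale (ell2 X) c f = (\<lambda>x. c * f x)"
  "vinner (ell2 X) f g = l2_inner f g"
  by (auto simp: ell2_def l2_inner_def)

lemma vnorm_ell2 [simp]: "vnorm (ell2 X) f = l2_norm f"
  by (simp add: vnorm_def l2_inner_self)

lemma vdist_ell2 [simp]: "vdist (ell2 X) f g = l2_norm (\<lambda>x. f x - g x)"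
  by (simp add: vdist_def)

section \<open>Completed limits of \<open>\<ell>\<^sup>2\<close>-spaces\<close>

text \<open>All stages consist of functions on one type, distinguished by their supports
  \<open>X n\<close>. Linearity and preservation of inner products make the connecting maps
  isometric embeddings; tensoring with a unit vector is the intended instance.\<close>

locale l2_system =
  fixes X :: "nat \<Rightarrow> 'v set" and \<iota> :: "nat \<Rightarrow> ('v \<Rightarrow> complex) \<Rightarrow> 'v \<Rightarrow> complex"
  assumes embed_closed: "f \<in> vecs (ell2 (X n)) \<Longrightarrow> \<iota> n f \<in> vecs (ell2 (X (Suc n)))"
    and embed_add: "\<lbrakk>f \<in> vecs (ell2 (X n)); g \<in> vecs (ell2 (X n))\<rbrakk>
      \<Longrightarrow> \<iota> n (\<lambda>x. f x + g x) = (\<lambda>x. \<iota> n f x + \<iota> n g x)"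
    and embed_scale: "f \<in> vecs (ell2 (X n)) \<Longrightarrow> \<iota> n (\<lambda>x. c * f x) = (\<lambda>x. c * \<iota> n f x)"
    and embed_inner: "\<lbrakk>f \<in> vecs (ell2 (X n)); g \<in> vecs (ell2 (X n))\<rbrakk>
      \<Longrightarrow> l2_inner (\<iota> n f) (\<iota> n g) = l2_inner f g"
begin

abbreviation V :: "nat \<Rightarrow> ('v \<Rightarrow> complex) set" where
  "V n \<equiv> vecs (ell2 (X n))"

abbreviation L :: "(nat \<Rightarrow> 'v \<Rightarrow> complex) set" where
  "L \<equiv> limit_seqs (\<lambda>n. ell2 (X n)) \<iota>"

abbreviation R :: "((nat \<Rightarrow> 'v \<Rightarrow> complex) \<times> (nat \<Rightarrow> 'v \<Rightarrow> complex)) set" where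
  "R \<equiv> limit_rel (\<lambda>n. ell2 (X n)) \<iota>"

abbreviation C :: "(nat \<Rightarrow> 'v \<Rightarrow> complex) set inner_space" where
  "C \<equiv> completed_limit (\<lambda>n. ell2 (X n)) \<iota>"

abbreviation cls :: "(nat \<Rightarrow> 'v \<Rightarrow> complex) \<Rightarrow> (nat \<Rightarrow> 'v \<Rightarrow> complex) set" where
  "cls s \<equiv> R `` {s}"

lemma V_summable: "f \<in> V n \<Longrightarrow> square_summable f"
  by (simp add: vecs_ell2)

lemma V_add: "\<lbrakk>f \<in> V n; g \<in> V n\<rbrakk> \<Longrightarrow> (\<lambda>x. f x + g x) \<in> V n"
  and V_scale: "f \<in> V n \<Longrightarrow> (\<lambda>x. c * f x) \<in> V n"
  by (auto simp: vecs_ell2)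

lemma connect_closed: "f \<in> V n \<Longrightarrow> connect \<iota> n d f \<in> V (n + d)"
  by (induction d) (auto simp: embed_closed)

lemma connect_add:
  "\<lbrakk>f \<in> V n; g \<in> V n\<rbrakk> \<Longrightarrow> connect \<iota> n d (\<lambda>x. f x + g x) = (\<lambda>x. connect \<iota> n d f x + connect \<iota> n d g x)"
  by (induction d) (auto simp: embed_add connect_closed)

lemma connect_scale:
  "f \<in> V n \<Longrightarrow> connect \<iota> n d (\<lambda>x. c * f x) = (\<lambda>x. c * connect \<iota> n d f x)"
  by (induction d) (auto simp: embed_scale connect_closed)

lemma connect_inner:
  "\<lbrakk>f \<in> V n; g \<in> V n\<rbrakk> \<Longrightarrow> l2_inner (connect \<iota> n d f) (connect \<iota> n d g) = l2_inner f g"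
  by (induction d) (auto simp: embed_inner connect_closed)

lemma connect_norm: "f \<in> V n \<Longrightarrow> l2_norm (connect \<iota> n d f) = l2_norm f"
  using connect_inner[of f n f d] unfolding l2_inner_self
  by (metis l2_norm_nonneg of_real_eq_iff power2_eq_iff_nonneg)

lemma in_L_iff:
  "s \<in> L \<longleftrightarrow> (\<forall>k. s k \<in> V k)
    \<and> (\<forall>e>0. \<exists>M. \<forall>n\<ge>M. \<forall>d. l2_norm (\<lambda>x. connect \<iota> n d (s n) x - s (n + d) x) < e)"
  by (simp add: limit_seqs_def)

lemma L_in_V: "s \<in> L \<Longrightarrow> s k \<in> V k"
  by (simp add: in_L_iff)

lemma L_summable: "s \<in> L \<Longrightarrow> square_summable (s k)"
  using L_in_V V_summable by blast

lemma L_connect_summable: "s \<in> L \<Longrightarrow> square_summable (connect \<iota> n d (s n))"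
  using L_in_V connect_closed V_summable by blast

lemma L_Cauchy:
  assumes "s \<in> L" "0 < e"
  obtains M where "\<And>n d. M \<le> n \<Longrightarrow> l2_norm (\<lambda>x. connect \<iota> n d (s n) x - s (n + d) x) < e"
  using assms unfolding in_L_iff by meson

text \<open>From stage \<open>M\<close> on, each term is within 1 of an isometric image of
  \<open>s M\<close>; the finitely many earlier terms are absorbed by a sum.\<close>

lemma L_bounded:
  assumes s: "s \<in> L"
  obtains B where "0 < B" "\<And>k. l2_norm (s k) \<le> B"
proof -
  obtain M where M: "\<And>n d. M \<le> n \<Longrightarrow> l2_norm (\<lambda>x. connect \<iota> n d (s n) x - s (n + d) x) < 1"
    using L_Cauchy[OF s, of 1] by auto
  define B where "B = l2_norm (s M) + 1 + (\<Sum>k<M. l2_norm (s k))"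
  have "l2_norm (s k) \<le> B" for k
  proof (cases "k < M")
    case True
    then have "l2_norm (s k) \<le> (\<Sum>k<M. l2_norm (s k))"
      by (intro member_le_sum) auto
    with l2_norm_nonneg[of "s M"] show ?thesis
      unfolding B_def by linarith
  next
    case False
    then obtain d where k: "k = M + d"
      by (metis le_Suc_ex not_less)
    have "l2_norm (s k) \<le> l2_norm (\<lambda>x. s k x - connect \<iota> M d (s M) x) + l2_norm (connect \<iota> M d (s M))"
      by (intro l2_norm_triangle_diff L_summable L_connect_summable s)
    also have "\<dots> \<le> 1 + l2_norm (s M)"
      using M[of M d] L_in_V[OF s, of M] k
      by (simp add: connect_norm l2_norm_minus_commute[of "s (M + d)" "connect \<iota> M d (s M)"])
    also have "\<dots> \<le> B"
      unfolding B_def by (simp add: sum_nonneg)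
    finally show ?thesis .
  qed
  moreover have "0 < B"
    by (simp add: B_def add_nonneg_pos add_pos_nonneg sum_nonneg)
  ultimately show ?thesis
    using that by blast
qed

lemma in_R_iff: "(s, t) \<in> R \<longleftrightarrow> s \<in> L \<and> t \<in> L \<and> (\<lambda>k. l2_norm (\<lambda>x. s k x - t k x)) \<longlonglongrightarrow> 0"
  by (simp add: limit_rel_def)

lemma R_D:
  assumes "(s, t) \<in> R"
  shows "s \<in> L" "t \<in> L" "(\<lambda>k. l2_norm (\<lambda>x. s k x - t k x)) \<longlonglongrightarrow> 0"
  using assms by (auto simp: in_R_iff)

lemma equiv_R: "equiv L R"
proof (rule equivI)
  show "R \<subseteq> L \<times> L"
    by (auto simp: limit_rel_def)
  show "refl_on L R"
    by (rule refl_onI) (auto simp: in_R_iff)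
  show "sym R"
  proof (rule symI)
    fix s t assume "(s, t) \<in> R"
    moreover have "(\<lambda>k. l2_norm (\<lambda>x. s k x - t k x)) = (\<lambda>k. l2_norm (\<lambda>x. t k x - s k x))"
      by (intro ext l2_norm_minus_commute)
    ultimately show "(t, s) \<in> R"
      by (simp add: in_R_iff)
  qed
  show "trans R"
  proof (rule transI)
    fix r s t assume rs: "(r, s) \<in> R" and st: "(s, t) \<in> R"
    then have L: "r \<in> L" "s \<in> L" "t \<in> L"
      by (auto simp: in_R_iff)
    have "(\<lambda>k. l2_norm (\<lambda>x. r k x - t k x)) \<longlonglongrightarrow> 0"
    proof (rule tendsto_sandwich[OF _ _ tendsto_const])
      show "(\<lambda>k. l2_norm (\<lambda>x. r k x - s k x) + l2_norm (\<lambda>x. s k x - t k x)) \<longlonglongrightarrow> 0"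
        using tendsto_add[of _ 0 sequentially _ 0, simplified, OF R_D(3)[OF rs] R_D(3)[OF st]] .
    qed (use L in \<open>simp_all add: l2_norm_triangle3 L_summable\<close>)
    with L show "(r, t) \<in> R"
      by (simp add: in_R_iff)
  qed
qed

section \<open>Classes and arbitrary representatives\<close>

lemma cls_eqI: "(s, t) \<in> R \<Longrightarrow> cls s = cls t"
  using equiv_R by (rule equiv_class_eq)

lemma cls_eq_iff: "\<lbrakk>s \<in> L; t \<in> L\<rbrakk> \<Longrightarrow> cls s = cls t \<longleftrightarrow> (s, t) \<in> R"
  using equiv_R by (rule eq_equiv_class_iff)

text \<open>The operations of \<open>completed_limit\<close> refer to chosen representatives; this
  equivalence is what allows them to be computed with any given sequence.\<close>

lemma rep_cls: "s \<in> L \<Longrightarrow> (s, rep (cls s)) \<in> R"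
  unfolding rep_def using someI[of "\<lambda>t. t \<in> cls s" s] equiv_class_self[OF equiv_R] by blast

lemma cls_in_vecs: "s \<in> L \<Longrightarrow> cls s \<in> vecs C"
  by (simp add: completed_limit_def quotientI)

lemma vecs_C_E:
  assumes "v \<in> vecs C"
  obtains s where "s \<in> L" "v = cls s"
  using assms by (auto simp: completed_limit_def elim: quotientE)

lemma L_add:
  assumes s: "s \<in> L" and t: "t \<in> L"
  shows "(\<lambda>k x. s k x + t k x) \<in> L"
  unfolding in_L_iff
proof (intro conjI allI impI)
  fix e :: real assume "0 < e"
  then have e: "0 < e / 2" by simp
  obtain M where M: "\<And>n d. M \<le> n \<Longrightarrow> l2_norm (\<lambda>x. connect \<iota> n d (s n) x - s (n + d) x) < e / 2"
    using L_Cauchy[OF s e] by blast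
  obtain M' where M': "\<And>n d. M' \<le> n \<Longrightarrow> l2_norm (\<lambda>x. connect \<iota> n d (t n) x - t (n + d) x) < e / 2"
    using L_Cauchy[OF t e] by blast
  have "l2_norm (\<lambda>x. connect \<iota> n d (\<lambda>x. s n x + t n x) x - (s (n + d) x + t (n + d) x)) < e"
    if n: "max M M' \<le> n" for n d
  proof -
    have "l2_norm (\<lambda>x. connect \<iota> n d (\<lambda>x. s n x + t n x) x - (s (n + d) x + t (n + d) x))
        = l2_norm (\<lambda>x. (connect \<iota> n d (s n) x - s (n + d) x) + (connect \<iota> n d (t n) x - t (n + d) x))"
      using L_in_V s t by (subst connect_add) (auto simp: algebra_simps)
    also have "\<dots> \<le> l2_norm (\<lambda>x. connect \<iota> n d (s n) x - s (n + d) x)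
        + l2_norm (\<lambda>x. connect \<iota> n d (t n) x - t (n + d) x)"
      by (intro l2_norm_triangle square_summable_diff L_summable L_connect_summable s t)
    also have "\<dots> < e"
      using M[of n d] M'[of n d] n by simp
    finally show ?thesis .
  qed
  then show "\<exists>M. \<forall>n\<ge>M. \<forall>d.
      l2_norm (\<lambda>x. connect \<iota> n d (\<lambda>x. s n x + t n x) x - (s (n + d) x + t (n + d) x)) < e"
    by blast
qed (intro V_add L_in_V s t)

lemma L_scale:
  assumes s: "s \<in> L"
  shows "(\<lambda>k x. c * s k x) \<in> L"
  unfolding in_L_iff
proof (intro conjI allI impI)
  fix e :: real assume e: "0 < e"
  \<comment> \<open>The summand 1 keeps the denominator positive when \<open>c\<close> is 0.\<close>
  have c: "0 < cmod c + 1"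
    by (simp add: add_nonneg_pos)
  obtain M where M: "\<And>n d. M \<le> n \<Longrightarrow> l2_norm (\<lambda>x. connect \<iota> n d (s n) x - s (n + d) x) < e / (cmod c + 1)"
    using L_Cauchy[OF s, of "e / (cmod c + 1)"] e c by auto
  have "l2_norm (\<lambda>x. connect \<iota> n d (\<lambda>x. c * s n x) x - c * s (n + d) x) < e" if n: "M \<le> n" for n d
  proof -
    have "l2_norm (\<lambda>x. connect \<iota> n d (\<lambda>x. c * s n x) x - c * s (n + d) x)
        = cmod c * l2_norm (\<lambda>x. connect \<iota> n d (s n) x - s (n + d) x)"
      using L_in_V[OF s] by (simp add: connect_scale flip: l2_norm_scale right_diff_distrib)
    also have "\<dots> \<le> (cmod c + 1) * l2_norm (\<lambda>x. connect \<iota> n d (s n) x - s (n + d) x)"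
      by (intro mult_right_mono) auto
    also have "\<dots> < e"
      using M[OF n, of d] c by (simp add: field_simps)
    finally show ?thesis .
  qed
  then show "\<exists>M. \<forall>n\<ge>M. \<forall>d. l2_norm (\<lambda>x. connect \<iota> n d (\<lambda>x. c * s n x) x - c * s (n + d) x) < e"
    by blast
qed (intro V_scale L_in_V s)

lemma L_diff:
  assumes "s \<in> L" "t \<in> L"
  shows "(\<lambda>k x. s k x - t k x) \<in> L"
  using L_add[OF assms(1) L_scale[OF assms(2), of "- 1"]] by simp

text \<open>Passing to the chosen representatives changes the sum by two null sequences.\<close>

lemma vadd_cls:
  assumes s: "s \<in> L" and t: "t \<in> L"
  shows "vadd C (cls s) (cls t) = cls (\<lambda>k x. s k x + t k x)"
proof -
  let ?s = "rep (cls s)" and ?t = "rep (cls t)"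
  note rs = R_D[OF rep_cls[OF s]] and rt = R_D[OF rep_cls[OF t]]
  have "(\<lambda>k. l2_norm (\<lambda>x. s k x + t k x - (?s k x + ?t k x))) \<longlonglongrightarrow> 0"
  proof (rule tendsto_sandwich[OF _ _ tendsto_const])
    show "(\<lambda>k. l2_norm (\<lambda>x. s k x - ?s k x) + l2_norm (\<lambda>x. t k x - ?t k x)) \<longlonglongrightarrow> 0"
      using tendsto_add[OF rs(3) rt(3)] by simp
    have "l2_norm (\<lambda>x. s k x + t k x - (?s k x + ?t k x))
        \<le> l2_norm (\<lambda>x. s k x - ?s k x) + l2_norm (\<lambda>x. t k x - ?t k x)" for k
      using l2_norm_triangle[of "\<lambda>x. s k x - ?s k x" "\<lambda>x. t k x - ?t k x"] rs rt L_summable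
      by (simp add: add_diff_add square_summable_diff)
    then show "\<forall>\<^sub>F k in sequentially. l2_norm (\<lambda>x. s k x + t k x - (?s k x + ?t k x))
        \<le> l2_norm (\<lambda>x. s k x - ?s k x) + l2_norm (\<lambda>x. t k x - ?t k x)"
      by simp
  qed auto
  then have "(\<lambda>k x. s k x + t k x, \<lambda>k x. ?s k x + ?t k x) \<in> R"
    using L_add rs rt by (simp add: in_R_iff)
  from cls_eqI[OF this] show ?thesis
    by (simp add: completed_limit_def)
qed

lemma vscale_cls:
  assumes s: "s \<in> L"
  shows "vscale C c (cls s) = cls (\<lambda>k x. c * s k x)"
proof -
  let ?s = "rep (cls s)"
  note rs = R_D[OF rep_cls[OF s]]
  have "(\<lambda>k. l2_norm (\<lambda>x. c * s k x - c * ?s k x)) \<longlonglongrightarrow> 0"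
    using tendsto_mult_left[OF rs(3), of "cmod c"] by (simp add: l2_norm_scale flip: right_diff_distrib)
  then have "(\<lambda>k x. c * s k x, \<lambda>k x. c * ?s k x) \<in> R"
    using L_scale rs by (simp add: in_R_iff)
  from cls_eqI[OF this] show ?thesis
    by (simp add: completed_limit_def)
qed

lemma convergent_inner:
  assumes s: "s \<in> L" and t: "t \<in> L"
  shows "convergent (\<lambda>k. l2_inner (s k) (t k))"
proof -
  obtain B where B: "0 < B" "\<And>k. l2_norm (s k) \<le> B"
    using L_bounded[OF s] by blast
  obtain B' where B': "0 < B'" "\<And>k. l2_norm (t k) \<le> B'"
    using L_bounded[OF t] by blast
  have "Cauchy (\<lambda>k. l2_inner (s k) (t k))"
    unfolding Cauchy_altdef
  proof (intro allI impI)
    fix e :: real assume e: "0 < e"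
    obtain M where M: "\<And>n d. M \<le> n \<Longrightarrow> l2_norm (\<lambda>x. connect \<iota> n d (s n) x - s (n + d) x) < e / (2 * B')"
      using L_Cauchy[OF s, of "e / (2 * B')"] e B'(1) by auto
    obtain M' where M': "\<And>n d. M' \<le> n \<Longrightarrow> l2_norm (\<lambda>x. connect \<iota> n d (t n) x - t (n + d) x) < e / (2 * B)"
      using L_Cauchy[OF t, of "e / (2 * B)"] e B(1) by auto
    have "dist (l2_inner (s n) (t n)) (l2_inner (s n') (t n')) < e"
      if n: "max M M' \<le> n" and "n < n'" for n n'
    proof -
      obtain d where n': "n' = n + d"
        using \<open>n < n'\<close> less_imp_add_positive by blast
      \<comment> \<open>Both arguments are transported from stage \<open>n\<close> to stage
        \<open>n'\<close>, which preserves the inner product, so that the comparison takes place in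
        one space.\<close>
      have "dist (l2_inner (s n) (t n)) (l2_inner (s n') (t n'))
          = cmod (l2_inner (connect \<iota> n d (s n)) (connect \<iota> n d (t n)) - l2_inner (s n') (t n'))"
        using s t L_in_V by (simp add: connect_inner dist_norm)
      also have "\<dots> \<le> l2_norm (\<lambda>x. connect \<iota> n d (s n) x - s n' x) * l2_norm (connect \<iota> n d (t n))
          + l2_norm (s n') * l2_norm (\<lambda>x. connect \<iota> n d (t n) x - t n' x)"
        by (intro l2_inner_diff_le L_summable L_connect_summable s t)
      also have "\<dots> \<le> l2_norm (\<lambda>x. connect \<iota> n d (s n) x - s n' x) * B'
          + B * l2_norm (\<lambda>x. connect \<iota> n d (t n) x - t n' x)"
        using B B' L_in_V[OF t] by (intro add_mono mult_left_mono mult_right_mono) (auto simp: connect_norm)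
      also have "\<dots> < e"
      proof -
        have "l2_norm (\<lambda>x. connect \<iota> n d (s n) x - s n' x) * B' < e / 2"
          using M[of n d] n n' B' by (simp add: field_simps)
        moreover have "B * l2_norm (\<lambda>x. connect \<iota> n d (t n) x - t n' x) < e / 2"
          using M'[of n d] n n' B by (simp add: field_simps)
        ultimately show ?thesis by linarith
      qed
      finally show ?thesis .
    qed
    then show "\<exists>M. \<forall>m\<ge>M. \<forall>n>m. dist (l2_inner (s m) (t m)) (l2_inner (s n) (t n)) < e"
      by blast
  qed
  then show ?thesis
    by (simp add: Cauchy_convergent)
qed

text \<open>\<open>convergent_inner\<close>, applied to the chosen representatives, justifies the
  \<open>lim\<close> in the definition; the inner products of \<open>s\<close> and \<open>t\<close>
  differ from theirs by a null sequence.\<close>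

lemma vinner_cls:
  assumes s: "s \<in> L" and t: "t \<in> L"
  shows "(\<lambda>k. l2_inner (s k) (t k)) \<longlonglongrightarrow> vinner C (cls s) (cls t)"
proof -
  let ?s = "rep (cls s)" and ?t = "rep (cls t)"
  note rs = R_D[OF rep_cls[OF s]] and rt = R_D[OF rep_cls[OF t]]
  obtain B where B: "\<And>k. l2_norm (?s k) \<le> B"
    using L_bounded[OF rs(2)] by blast
  obtain B' where B': "\<And>k. l2_norm (t k) \<le> B'"
    using L_bounded[OF t] by blast
  have "(\<lambda>k. l2_inner (s k) (t k) - l2_inner (?s k) (?t k)) \<longlonglongrightarrow> 0"
  proof (rule Lim_null_comparison)
    show "(\<lambda>k. l2_norm (\<lambda>x. s k x - ?s k x) * B' + B * l2_norm (\<lambda>x. t k x - ?t k x)) \<longlonglongrightarrow> 0"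
      using tendsto_add[OF tendsto_mult_right[OF rs(3), of B'] tendsto_mult_left[OF rt(3), of B]]
      by simp
    have "cmod (l2_inner (s k) (t k) - l2_inner (?s k) (?t k))
        \<le> l2_norm (\<lambda>x. s k x - ?s k x) * B' + B * l2_norm (\<lambda>x. t k x - ?t k x)" for k
    proof (rule order_trans[OF l2_inner_diff_le])
      show "l2_norm (\<lambda>x. s k x - ?s k x) * l2_norm (t k) + l2_norm (?s k) * l2_norm (\<lambda>x. t k x - ?t k x)
        \<le> l2_norm (\<lambda>x. s k x - ?s k x) * B' + B * l2_norm (\<lambda>x. t k x - ?t k x)"
        by (intro add_mono mult_left_mono mult_right_mono B B') auto
    qed (use rs rt L_summable in auto)
    then show "\<forall>\<^sub>F k in sequentially. cmod (l2_inner (s k) (t k) - l2_inner (?s k) (?t k))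
        \<le> l2_norm (\<lambda>x. s k x - ?s k x) * B' + B * l2_norm (\<lambda>x. t k x - ?t k x)"
      by simp
  qed
  moreover have "(\<lambda>k. l2_inner (?s k) (?t k)) \<longlonglongrightarrow> vinner C (cls s) (cls t)"
    using convergent_inner[OF rs(2) rt(2)] by (simp add: convergent_LIMSEQ_iff completed_limit_def)
  ultimately show ?thesis
    using tendsto_add[of "\<lambda>k. l2_inner (s k) (t k) - l2_inner (?s k) (?t k)" 0 sequentially
        "\<lambda>k. l2_inner (?s k) (?t k)"] by simp
qed

lemma vnorm_cls:
  assumes s: "s \<in> L"
  shows "(\<lambda>k. l2_norm (s k)) \<longlonglongrightarrow> vnorm C (cls s)"
proof -
  have "(\<lambda>k. sqrt (Re (l2_inner (s k) (s k)))) \<longlonglongrightarrow> vnorm C (cls s)"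
    unfolding vnorm_def by (intro tendsto_intros vinner_cls s)
  then show ?thesis
    by (simp add: l2_inner_self)
qed

text \<open>With the distance written as a limit of stagewise distances, the triangle inequality,
  symmetry and nonnegativity pass over from \<open>l2_norm\<close>.\<close>

lemma vdist_cls:
  assumes s: "s \<in> L" and t: "t \<in> L"
  shows "(\<lambda>k. l2_norm (\<lambda>x. s k x - t k x)) \<longlonglongrightarrow> vdist C (cls s) (cls t)"
proof -
  have "vdist C (cls s) (cls t) = vnorm C (cls (\<lambda>k x. s k x - t k x))"
    using L_scale[OF t, of "- 1"] s t by (simp add: vdist_def vscale_cls vadd_cls)
  then show ?thesis
    using vnorm_cls[OF L_diff[OF s t]] by simp
qed

lemma vdist_triangle:
  assumes "u \<in> vecs C" "v \<in> vecs C" "w \<in> vecs C"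
  shows "vdist C u w \<le> vdist C u v + vdist C v w"
proof -
  obtain r s t where L: "r \<in> L" "s \<in> L" "t \<in> L" and eq: "u = cls r" "v = cls s" "w = cls t"
    using assms by (metis vecs_C_E)
  show ?thesis
    unfolding eq
    by (rule LIMSEQ_le[OF vdist_cls[OF L(1,3)] tendsto_add[OF vdist_cls[OF L(1,2)] vdist_cls[OF L(2,3)]]])
      (use L in \<open>auto intro!: l2_norm_triangle3 L_summable\<close>)
qed

lemma vdist_commute:
  assumes "u \<in> vecs C" "v \<in> vecs C"
  shows "vdist C u v = vdist C v u"
proof -
  obtain r s where L: "r \<in> L" "s \<in> L" and eq: "u = cls r" "v = cls s"
    using assms by (metis vecs_C_E)
  have "(\<lambda>k. l2_norm (\<lambda>x. r k x - s k x)) = (\<lambda>k. l2_norm (\<lambda>x. s k x - r k x))"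
    by (intro ext l2_norm_minus_commute)
  then show ?thesis
    using vdist_cls[OF L] vdist_cls[OF L(2,1)] by (simp add: eq LIMSEQ_unique)
qed

lemma vdist_eq_0D:
  assumes "u \<in> vecs C" "v \<in> vecs C" "vdist C u v = 0"
  shows "u = v"
proof -
  obtain r s where L: "r \<in> L" "s \<in> L" and eq: "u = cls r" "v = cls s"
    using assms(1,2) by (metis vecs_C_E)
  show ?thesis
    using vdist_cls[OF L] assms(3) L by (simp add: eq cls_eq_iff in_R_iff)
qed

lemma vdist_nonneg:
  assumes "u \<in> vecs C" "v \<in> vecs C"
  shows "0 \<le> vdist C u v"
proof -
  obtain r s where L: "r \<in> L" "s \<in> L" and eq: "u = cls r" "v = cls s"
    using assms by (metis vecs_C_E)
  show ?thesis
    unfolding eq using vdist_cls[OF L] by (rule LIMSEQ_le_const) auto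
qed

lemma vadd_closed: "\<lbrakk>u \<in> vecs C; v \<in> vecs C\<rbrakk> \<Longrightarrow> vadd C u v \<in> vecs C"
  by (elim vecs_C_E) (simp add: vadd_cls L_add cls_in_vecs)

lemma vscale_closed: "u \<in> vecs C \<Longrightarrow> vscale C c u \<in> vecs C"
  by (elim vecs_C_E) (simp add: vscale_cls L_scale cls_in_vecs)

text \<open>Isometry on differences sends equivalent sequences to equivalent ones, so the class of
  the image does not depend on the chosen representative.\<close>

lemma limit_op_cls:
  assumes s: "s \<in> L"
    and T: "\<And>t. t \<in> L \<Longrightarrow> (\<lambda>k. T k (t k)) \<in> L"
    and isometry: "\<And>k f g. \<lbrakk>f \<in> V k; g \<in> V k\<rbrakk>
      \<Longrightarrow> l2_norm (\<lambda>x. T k f x - T k g x) = l2_norm (\<lambda>x. f x - g x)"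
  shows "limit_op (\<lambda>n. ell2 (X n)) \<iota> T (cls s) = cls (\<lambda>k. T k (s k))"
proof -
  let ?s = "rep (cls s)"
  note rs = R_D[OF rep_cls[OF s]]
  have "(\<lambda>k. T k (s k), \<lambda>k. T k (?s k)) \<in> R"
    using rs T L_in_V by (simp add: in_R_iff isometry)
  from cls_eqI[OF this] show ?thesis
    by (simp add: limit_op_def)
qed

text \<open>Since \<open>tensor_op\<close> is obtained by choice, its values on the carrier have to
  be recovered from uniqueness. The distance of the two candidates is bounded by a sum of two
  distances tending to 0.\<close>

lemma strong_limit_unique:
  assumes S: "bounded_operator C S" and S': "bounded_operator C S'"
    and T: "\<And>j v. v \<in> vecs C \<Longrightarrow> T j v \<in> vecs C"
    and lim: "strong_limit C T S \<F>" "strong_limit C T S' \<F>"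
    and nontriv: "\<F> \<noteq> bot" and v: "v \<in> vecs C"
  shows "S v = S' v"
proof -
  have in_C: "S v \<in> vecs C" "S' v \<in> vecs C"
    using S S' v by (auto simp: bounded_operator_def)
  have "((\<lambda>j. vdist C (T j v) (S v) + vdist C (T j v) (S' v)) \<longlongrightarrow> 0) \<F>"
    using tendsto_add[of "\<lambda>j. vdist C (T j v) (S v)" 0 \<F> "\<lambda>j. vdist C (T j v) (S' v)" 0] lim v
    by (simp add: strong_limit_def)
  moreover have "vdist C (S v) (S' v) \<le> vdist C (T j v) (S v) + vdist C (T j v) (S' v)" for j
    using vdist_triangle[of "S v" "T j v" "S' v"] vdist_commute[of "S v" "T j v"] in_C T[OF v] by simp
  ultimately have "vdist C (S v) (S' v) \<le> 0"
    by (intro tendsto_lowerbound[OF _ _ nontriv]) auto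
  then show ?thesis
    using vdist_eq_0D[OF in_C] vdist_nonneg[OF in_C] by simp
qed

end

section \<open>Tensor products of regular representations\<close>

text \<open>Iterated summation gives the value; summability on the product set comes from the
  moduli, whose iterated sums are finite.\<close>

lemma has_sum_product:
  fixes a :: "'a \<Rightarrow> complex" and b :: "'b \<Rightarrow> complex"
  assumes a: "(a has_sum A) S" and b: "(b has_sum B) T"
  shows "((\<lambda>(x, y). a x * b y) has_sum A * B) (S \<times> T)"
proof (rule has_sum_SigmaI)
  show "((\<lambda>y. case (x, y) of (x, y) \<Rightarrow> a x * b y) has_sum a x * B) T" for x
    using has_sum_cmult_right[OF b] by simp
  show "((\<lambda>x. a x * B) has_sum A * B) S"
    by (rule has_sum_cmult_left[OF a])
  have na: "(\<lambda>x. cmod (a x)) summable_on S" and nb: "(\<lambda>x. cmod (b x)) summable_on T"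
    using a b has_sum_imp_summable summable_on_iff_abs_summable_on_complex by blast+
  have "(\<lambda>p. case p of (x, y) \<Rightarrow> cmod (a x) * cmod (b y)) summable_on S \<times> T"
    by (rule summable_on_SigmaI[where g = "\<lambda>x. cmod (a x) * (\<Sum>\<^sub>\<infinity>y\<in>T. cmod (b y))"])
      (auto intro!: has_sum_cmult_right has_sum_infsum nb summable_on_cmult_left na)
  then show "(\<lambda>(x, y). a x * b y) summable_on S \<times> T"
    by (simp add: summable_on_iff_abs_summable_on_complex norm_mult case_prod_unfold)
qed

text \<open>Nonempty lists correspond to pairs by splitting off the last entry, and the empty list
  contributes 0.\<close>

lemma has_sum_butlast_last:
  fixes a :: "'a list \<Rightarrow> complex" and b :: "'a \<Rightarrow> complex"
  assumes "(a has_sum A) UNIV" and "(b has_sum B) UNIV"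
  shows "((\<lambda>xs. if xs = [] then 0 else a (butlast xs) * b (last xs)) has_sum A * B) UNIV"
proof -
  let ?f = "\<lambda>xs. if xs = [] then 0 else a (butlast xs) * b (last xs)"
  have bij: "bij_betw (\<lambda>(xs, x). xs @ [x]) (UNIV \<times> UNIV) {xs :: 'a list. xs \<noteq> []}"
    by (rule bij_betwI[where g = "\<lambda>xs. (butlast xs, last xs)"]) auto
  have "((\<lambda>p. ?f (case p of (xs, x) \<Rightarrow> xs @ [x])) has_sum A * B) (UNIV \<times> UNIV)"
    using has_sum_product[OF assms] by (simp add: case_prod_unfold)
  then have "(?f has_sum A * B) {xs. xs \<noteq> []}"
    by (simp only: has_sum_reindex_bij_betw[OF bij, of ?f])
  then show ?thesis
    by (rule has_sum_cong_neutral[THEN iffD1, rotated -1]) auto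
qed

lemma
  fixes \<psi> \<omega> :: "'a list \<Rightarrow> complex"
  assumes "square_summable \<psi>" "square_summable f"
  shows square_summable_append_factor: "square_summable (append_factor \<psi> f)"
    and l2_inner_append_factor: "\<lbrakk>square_summable \<omega>; square_summable g\<rbrakk>
      \<Longrightarrow> l2_inner (append_factor \<psi> f) (append_factor \<omega> g) = l2_inner \<psi> \<omega> * l2_inner f g"
proof -
  have *: "((\<lambda>xs. append_factor \<psi> f xs * cnj (append_factor \<omega> g xs)) has_sum l2_inner \<psi> \<omega> * l2_inner f g) UNIV"
    if "square_summable \<psi>" "square_summable \<omega>" "square_summable f" "square_summable g"
    for \<psi> \<omega> :: "'a list \<Rightarrow> complex" and f g
    using has_sum_butlast_last[OF l2_inner_has_sum[OF that(1,2)] l2_inner_has_sum[OF that(3,4)]]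
    by (rule has_sum_cong[THEN iffD1, rotated]) (simp add: append_factor_def)
  \<comment> \<open>The diagonal case of the product formula has the squared moduli as
    summands.\<close>
  show "square_summable (append_factor \<psi> f)"
    using *[of \<psi> \<psi> f f] assms by (auto simp: square_summable_iff_summable summable_on_def)
  show "l2_inner (append_factor \<psi> f) (append_factor \<omega> g) = l2_inner \<psi> \<omega> * l2_inner f g"
    if "square_summable \<omega>" "square_summable g"
    unfolding l2_inner_def[of "append_factor \<psi> f"] using * assms that by (intro infsumI) blast
qed

section \<open>Simultaneous translation in a set of factors\<close>

definition cocycle_weight :: "(nat \<Rightarrow> 'g::ab_group_add \<Rightarrow> 'g \<Rightarrow> complex) \<Rightarrow> nat set \<Rightarrow> 'g \<Rightarrow> 'g list \<Rightarrow> complex" where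
  "cocycle_weight u K x xs = (\<Prod>i\<in>K \<inter> {..<length xs}. u i (- (xs ! i)) x)"

definition shift_at :: "nat set \<Rightarrow> 'g::ab_group_add \<Rightarrow> 'g list \<Rightarrow> 'g list" where
  "shift_at K x xs = map (\<lambda>i. if i \<in> K then xs ! i - x else xs ! i) [0..<length xs]"

text \<open>An explicit formula for \<open>regular_rep (u i) x\<close> acting in all factors
  \<open>i\<close> in \<open>K\<close> at once. Unlike \<open>in_factors\<close>, it keeps this
  meaning for infinite \<open>K\<close>, and \<open>K = UNIV\<close> will yield the limit
  operator.\<close>

definition translate_factors ::
  "(nat \<Rightarrow> 'g::ab_group_add \<Rightarrow> 'g \<Rightarrow> complex) \<Rightarrow> nat set \<Rightarrow> 'g \<Rightarrow> ('g list \<Rightarrow> complex) \<Rightarrow> 'g list \<Rightarrow> complex" where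
  "translate_factors u K x \<psi> = (\<lambda>xs. cocycle_weight u K x xs * \<psi> (shift_at K x xs))"

lemma length_shift_at [simp]: "length (shift_at K x xs) = length xs"
  by (simp add: shift_at_def)

lemma nth_shift_at: "i < length xs \<Longrightarrow> shift_at K x xs ! i = (if i \<in> K then xs ! i - x else xs ! i)"
  by (simp add: shift_at_def)

lemma shift_at_cong:
  "K \<inter> {..<length xs} = K' \<inter> {..<length xs} \<Longrightarrow> shift_at K x xs = shift_at K' x xs"
  by (rule nth_equalityI) (auto simp: nth_shift_at)

lemma shift_at_shift_at: "shift_at K y (shift_at K x xs) = shift_at K (x + y) xs"
  by (rule nth_equalityI) (auto simp: nth_shift_at)

lemma shift_at_0 [simp]: "shift_at K 0 xs = xs"
  by (rule nth_equalityI) (auto simp: nth_shift_at)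

lemma shift_at_empty [simp]: "shift_at {} x xs = xs"
  by (rule nth_equalityI) (auto simp: nth_shift_at)

lemma bij_shift_at: "bij (shift_at K x)"
  by (rule o_bij[where g = "shift_at K (- x)"]) (auto simp: shift_at_shift_at)

text \<open>Splitting off the last entry matches the shape of \<open>append_factor\<close>.\<close>

lemma shift_at_snoc:
  "shift_at K x (xs @ [a]) = shift_at K x xs @ [if length xs \<in> K then a - x else a]"
  by (rule nth_equalityI) (auto simp: nth_shift_at nth_append less_Suc_eq)

lemma cocycle_weight_snoc:
  "cocycle_weight u K x (xs @ [a])
    = cocycle_weight u K x xs * (if length xs \<in> K then u (length xs) (- a) x else 1)"
proof -
  have *: "(\<Prod>i\<in>K \<inter> {..<length xs}. u i (- ((xs @ [a]) ! i)) x) = cocycle_weight u K x xs"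
    unfolding cocycle_weight_def by (rule prod.cong) (auto simp: nth_append)
  have "K \<inter> {..<length (xs @ [a])}
      = (if length xs \<in> K then insert (length xs) (K \<inter> {..<length xs}) else K \<inter> {..<length xs})"
    by (auto simp: less_Suc_eq)
  then show ?thesis
    by (simp add: cocycle_weight_def[of _ _ _ "xs @ [a]"] * mult.commute)
qed

text \<open>Since \<open>i\<close> is not in \<open>K\<close>, changing entry \<open>i\<close>
  leaves the weight over \<open>K\<close> alone, and the operator adds just the phase and the shift
  of index \<open>i\<close>. If the list is too short, \<open>i\<close> affects neither
  side.\<close>

lemma in_factor_translate_factors:
  assumes "i \<notin> K"
  shows "in_factor i (regular_rep (u i) x) (translate_factors u K x \<psi>) = translate_factors u (insert i K) x \<psi>"
proof
  fix xs :: "'a list"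
  show "in_factor i (regular_rep (u i) x) (translate_factors u K x \<psi>) xs = translate_factors u (insert i K) x \<psi> xs"
  proof (cases "i < length xs")
    case True
    have "cocycle_weight u K x (xs[i := xs ! i - x]) = cocycle_weight u K x xs"
      unfolding cocycle_weight_def using assms True by (intro prod.cong) (auto simp: nth_list_update)
    moreover have "cocycle_weight u (insert i K) x xs = u i (- (xs ! i)) x * cocycle_weight u K x xs"
      unfolding cocycle_weight_def using assms True by simp
    moreover have "shift_at K x (xs[i := xs ! i - x]) = shift_at (insert i K) x xs"
      using assms True by (intro nth_equalityI) (auto simp: nth_shift_at nth_list_update)
    ultimately show ?thesis
      using True by (simp add: in_factor_def regular_rep_def translate_factors_def)
  next
    case False
    then have eq: "insert i K \<inter> {..<length xs} = K \<inter> {..<length xs}"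
      by auto
    show ?thesis
      using False shift_at_cong[OF eq, of x]
      by (simp add: in_factor_def translate_factors_def cocycle_weight_def eq)
  qed
qed

text \<open>\<open>foldr\<close> adds the indices one at a time, each absent from the set already
  treated because the list is distinct.\<close>

lemma in_factors_regular_rep:
  assumes "finite J"
  shows "in_factors (\<lambda>i. regular_rep (u i) x) J = translate_factors u J x"
proof -
  have "foldr (\<lambda>i. in_factor i (regular_rep (u i) x)) is \<psi> = translate_factors u (set is) x \<psi>"
    if "distinct is" for "is" \<psi>
    using that
  proof (induction "is")
    case Nil
    then show ?case
      by (simp add: translate_factors_def cocycle_weight_def)
  next
    case (Cons i "is")
    then show ?case
      by (simp add: in_factor_translate_factors)
  qed
  then show ?thesis
    using assms by (auto simp: in_factors_def)
qed

lemma translate_factors_add: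
  "translate_factors u K x (\<lambda>xs. \<psi> xs + \<omega> xs)
    = (\<lambda>xs. translate_factors u K x \<psi> xs + translate_factors u K x \<omega> xs)"
  by (simp add: translate_factors_def distrib_left)

lemma translate_factors_diff:
  "translate_factors u K x (\<lambda>xs. \<psi> xs - \<omega> xs)
    = (\<lambda>xs. translate_factors u K x \<psi> xs - translate_factors u K x \<omega> xs)"
  by (simp add: translate_factors_def right_diff_distrib)

lemma translate_factors_scale:
  "translate_factors u K x (\<lambda>xs. c * \<psi> xs) = (\<lambda>xs. c * translate_factors u K x \<psi> xs)"
  by (simp add: translate_factors_def mult_ac)

lemma cmod_cocycle: "u \<in> cocycles \<Longrightarrow> cmod (u x y) = 1"
  by (simp add: cocycles_def)

lemma
  assumes u: "u \<in> cocycles" and f: "square_summable f"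
  shows square_summable_regular_rep: "square_summable (regular_rep u x f)"
    and l2_norm_regular_rep: "l2_norm (regular_rep u x f) = l2_norm f"
proof -
  have bij: "bij (\<lambda>y. y - x)"
    by (rule o_bij[where g = "\<lambda>y. y + x"]) auto
  have eq: "(\<lambda>y. (cmod (regular_rep u x f y))\<^sup>2) = (\<lambda>y. (cmod (f (y - x)))\<^sup>2)"
    using u by (simp add: regular_rep_def norm_mult cmod_cocycle)
  show "square_summable (regular_rep u x f)"
    using f summable_on_reindex_bij_betw[OF bij, of "\<lambda>y. (cmod (f y))\<^sup>2"]
    by (simp add: square_summable_def eq)
  show "l2_norm (regular_rep u x f) = l2_norm f"
    using infsum_reindex_bij_betw[OF bij, of "\<lambda>y. (cmod (f y))\<^sup>2"]
    by (simp add: l2_norm_def eq)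
qed

locale cocycle_family =
  fixes u :: "nat \<Rightarrow> 'g::ab_group_add \<Rightarrow> 'g \<Rightarrow> complex"
  assumes u: "u i \<in> cocycles"
begin

lemma cmod_cocycle_weight: "cmod (cocycle_weight u K x xs) = 1"
  by (simp add: cocycle_weight_def prod_norm[symmetric] cmod_cocycle[OF u])

lemma square_summable_translate_factors:
  "square_summable (translate_factors u K x \<psi>) \<longleftrightarrow> square_summable \<psi>"
  using summable_on_reindex_bij_betw[OF bij_shift_at, of "\<lambda>xs. (cmod (\<psi> xs))\<^sup>2" K x]
  by (simp add: square_summable_def translate_factors_def norm_mult cmod_cocycle_weight)

text \<open>The weights cancel because they have modulus 1, and the shift is a bijection of
  lists.\<close>

lemma l2_inner_translate_factors:
  "l2_inner (translate_factors u K x \<psi>) (translate_factors u K x \<omega>) = l2_inner \<psi> \<omega>"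
proof -
  have "translate_factors u K x \<psi> xs * cnj (translate_factors u K x \<omega> xs)
      = \<psi> (shift_at K x xs) * cnj (\<omega> (shift_at K x xs))" for xs
  proof -
    have "cocycle_weight u K x xs * cnj (cocycle_weight u K x xs) = 1"
      by (simp add: complex_norm_square[symmetric] cmod_cocycle_weight)
    then show ?thesis
      by (simp add: translate_factors_def mult_ac)
  qed
  then show ?thesis
    using infsum_reindex_bij_betw[OF bij_shift_at, of "\<lambda>xs. \<psi> xs * cnj (\<omega> xs)" K x]
    by (simp add: l2_inner_def)
qed

lemma l2_norm_translate_factors: "l2_norm (translate_factors u K x \<psi>) = l2_norm \<psi>"
  using l2_inner_translate_factors[of K x \<psi> \<psi>] unfolding l2_inner_self
  by (metis l2_norm_nonneg of_real_eq_iff power2_eq_iff_nonneg)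

lemma translate_factors_0: "translate_factors u K 0 \<psi> = \<psi>"
proof -
  have "u i y 0 = 1" for i y
    using u[of i] by (simp add: cocycles_def)
  then show ?thesis
    by (simp add: translate_factors_def cocycle_weight_def)
qed

text \<open>In every factor this is the cocycle identity for the triple \<open>(- z, x, y)\<close>,
  where \<open>z\<close> is the entry of the list.\<close>

lemma cocycle_weight_add:
  "cocycle_weight u K x xs * cocycle_weight u K y (shift_at K x xs)
    = (\<Prod>i\<in>K \<inter> {..<length xs}. u i x y) * cocycle_weight u K (x + y) xs"
proof -
  have "u i (- z) x * u i (- (z - x)) y = u i x y * u i (- z) (x + y)" for i z
  proof -
    have "u i (- z) x * u i (- z + x) y = u i x y * u i (- z) (x + y)"
      using u[of i] unfolding cocycles_def by blast
    then show ?thesis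
      by simp
  qed
  then show ?thesis
    unfolding cocycle_weight_def prod.distrib[symmetric] length_shift_at
    by (intro prod.cong) (auto simp: nth_shift_at)
qed

end

section \<open>The infinite tensor product\<close>

text \<open>The last assumption is the sufficient condition for convergence. Cocycles and unit
  vectors are arbitrary here; cubes enter only with the interpretation of the locale.\<close>

locale cocycle_system = cocycle_family u
  for u :: "nat \<Rightarrow> 'g::ab_group_add \<Rightarrow> 'g \<Rightarrow> complex" +
  fixes \<phi> :: "nat \<Rightarrow> 'g \<Rightarrow> complex"
  assumes \<phi>_summable: "square_summable (\<phi> n)" and \<phi>_norm: "l2_norm (\<phi> n) = 1"
    and coefficients: "summable (\<lambda>i. cmod (1 - l2_inner (regular_rep (u i) x (\<phi> i)) (\<phi> i)))"
begin

sublocale l2_system "\<lambda>n. {xs :: 'g list. length xs = n}" "\<lambda>n \<psi>. append_factor \<psi> (\<phi> n)"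
proof
  fix n c and f g :: "'g list \<Rightarrow> complex"
  assume f: "f \<in> vecs (ell2 {xs. length xs = n})"
  then have sf: "square_summable f"
    by (simp add: vecs_ell2)
  show "append_factor f (\<phi> n) \<in> vecs (ell2 {xs. length xs = Suc n})"
  proof -
    have "append_factor f (\<phi> n) xs = 0" if "length xs \<noteq> Suc n" for xs
      using f that by (cases xs rule: rev_cases) (auto simp: vecs_ell2 append_factor_def)
    then show ?thesis
      using sf \<phi>_summable by (simp add: vecs_ell2 square_summable_append_factor)
  qed
  show "append_factor (\<lambda>x. c * f x) (\<phi> n) = (\<lambda>x. c * append_factor f (\<phi> n) x)"
    by (auto simp: append_factor_def)
  assume g: "g \<in> vecs (ell2 {xs. length xs = n})"
  then have sg: "square_summable g"
    by (simp add: vecs_ell2)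
  show "append_factor (\<lambda>x. f x + g x) (\<phi> n) = (\<lambda>x. append_factor f (\<phi> n) x + append_factor g (\<phi> n) x)"
    by (auto simp: append_factor_def distrib_right)
  \<comment> \<open>The appended factor contributes the squared norm of \<open>\<phi> n\<close>,
    which is 1.\<close>
  show "l2_inner (append_factor f (\<phi> n)) (append_factor g (\<phi> n)) = l2_inner f g"
    using sf sg by (simp add: l2_inner_append_factor \<phi>_summable l2_inner_self \<phi>_norm)
qed

abbreviation \<iota> :: "nat \<Rightarrow> ('g list \<Rightarrow> complex) \<Rightarrow> 'g list \<Rightarrow> complex" where
  "\<iota> n \<psi> \<equiv> append_factor \<psi> (\<phi> n)"

abbreviation W :: "nat set \<Rightarrow> 'g \<Rightarrow> ('g list \<Rightarrow> complex) \<Rightarrow> 'g list \<Rightarrow> complex" where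
  "W \<equiv> translate_factors u"

definition coefficient_defect :: "'g \<Rightarrow> nat \<Rightarrow> real" where
  "coefficient_defect x i = cmod (1 - l2_inner (regular_rep (u i) x (\<phi> i)) (\<phi> i))"

lemma inf_tensor_eq: "inf_tensor \<phi> = C"
  unfolding inf_tensor_def by (simp add: tensor_power_def[abs_def])

lemma W_closed: "\<psi> \<in> V n \<Longrightarrow> W K x \<psi> \<in> V n"
  by (auto simp: vecs_ell2 square_summable_translate_factors) (simp add: translate_factors_def)

text \<open>Vectors of stage \<open>n\<close> live on lists of length \<open>n\<close>, and
  translation preserves lengths, so indices from \<open>n\<close> on have no effect.\<close>

lemma W_restrict:
  assumes "\<psi> \<in> V n" "K \<inter> {..<n} = K' \<inter> {..<n}"
  shows "W K x \<psi> = W K' x \<psi>"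
proof
  fix xs
  show "W K x \<psi> xs = W K' x \<psi> xs"
  proof (cases "length xs = n")
    case True
    then show ?thesis
      using assms(2) shift_at_cong[of K xs K' x] by (simp add: translate_factors_def cocycle_weight_def)
  next
    case False
    then show ?thesis
      using assms(1) by (simp add: translate_factors_def vecs_ell2)
  qed
qed

text \<open>The appended factor has number \<open>n\<close> because factors are counted from 0; on
  lists of length other than \<open>n + 1\<close> both sides vanish.\<close>

lemma W_append_factor:
  assumes "\<psi> \<in> V n"
  shows "W K x (append_factor \<psi> f)
    = append_factor (W K x \<psi>) (if n \<in> K then regular_rep (u n) x f else f)"
proof
  fix xs
  show "W K x (append_factor \<psi> f) xs
    = append_factor (W K x \<psi>) (if n \<in> K then regular_rep (u n) x f else f) xs"
  proof (cases xs rule: rev_cases)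
    case Nil
    then show ?thesis
      by (simp add: translate_factors_def append_factor_def shift_at_def)
  next
    case (snoc ys a)
    then show ?thesis
      using assms by (cases "length ys = n")
        (auto simp: translate_factors_def append_factor_def cocycle_weight_snoc shift_at_snoc
          regular_rep_def vecs_ell2)
  qed
qed

text \<open>At stage \<open>n\<close> only indices of \<open>K\<close> below \<open>n\<close>
  contribute cocycle values, so the scalar is a finite product even for infinite
  \<open>K\<close>.\<close>

lemma W_compose:
  assumes "\<psi> \<in> V n"
  shows "W K x (W K y \<psi>) = (\<lambda>xs. (\<Prod>i\<in>K \<inter> {..<n}. u i x y) * W K (x + y) \<psi> xs)"
proof
  fix xs
  show "W K x (W K y \<psi>) xs = (\<Prod>i\<in>K \<inter> {..<n}. u i x y) * W K (x + y) \<psi> xs"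
  proof (cases "length xs = n")
    case True
    then show ?thesis
      using cocycle_weight_add[of K x xs y]
      by (simp add: translate_factors_def shift_at_shift_at)
  next
    case False
    then show ?thesis
      using assms by (simp add: translate_factors_def vecs_ell2)
  qed
qed

text \<open>Each appended factor multiplies the inner product by one coefficient: 1 if
  \<open>K\<close> and \<open>K'\<close> agree at \<open>i\<close>, and otherwise the matrix
  coefficient of \<open>\<phi> i\<close> or its conjugate.\<close>

lemma connect_W_inner:
  assumes \<psi>: "\<psi> \<in> V n" and K: "K \<inter> {..<n} = K' \<inter> {..<n}"
  shows "l2_inner (W K x (connect \<iota> n d \<psi>)) (W K' x (connect \<iota> n d \<psi>))
    = complex_of_real ((l2_norm \<psi>)\<^sup>2) * (\<Prod>i=n..<n + d.
        l2_inner (if i \<in> K then regular_rep (u i) x (\<phi> i) else \<phi> i)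
          (if i \<in> K' then regular_rep (u i) x (\<phi> i) else \<phi> i))"
proof (induction d)
  case 0
  show ?case
    using W_restrict[OF \<psi> K, of x] by (simp add: l2_inner_self l2_norm_translate_factors)
next
  case (Suc d)
  have V: "connect \<iota> n d \<psi> \<in> V (n + d)"
    by (rule connect_closed[OF \<psi>])
  have "square_summable (W J x (connect \<iota> n d \<psi>))" for J
    using V_summable[OF W_closed[OF V]] .
  then show ?case
    using Suc V
    by (simp add: W_append_factor l2_inner_append_factor square_summable_regular_rep u \<phi>_summable
        del: of_real_power)
qed

text \<open>For isometries the squared distance is
  \<open>2 * (l2_norm \<psi>)\<^sup>2 * (1 - Re p)\<close>, with \<open>p\<close> the product of the
  coefficients \<open>w i\<close>. These have modulus at most 1, so the modulus of
  \<open>1 - p\<close> is at most the sum of the moduli of the \<open>1 - w i\<close>.\<close>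

lemma connect_W_diff:
  assumes \<psi>: "\<psi> \<in> V n" and K: "K \<inter> {..<n} = K' \<inter> {..<n}"
  shows "(l2_norm (\<lambda>xs. W K x (connect \<iota> n d \<psi>) xs - W K' x (connect \<iota> n d \<psi>) xs))\<^sup>2
    \<le> 2 * (l2_norm \<psi>)\<^sup>2 * (\<Sum>i=n..<n + d. if i \<in> K \<longleftrightarrow> i \<in> K' then 0 else coefficient_defect x i)"
proof -
  define w where "w i = l2_inner (if i \<in> K then regular_rep (u i) x (\<phi> i) else \<phi> i)
    (if i \<in> K' then regular_rep (u i) x (\<phi> i) else \<phi> i)" for i
  let ?p = "\<Prod>i=n..<n + d. w i"
  have V: "connect \<iota> n d \<psi> \<in> V (n + d)"
    by (rule connect_closed[OF \<psi>])
  have g: "square_summable (if P then regular_rep (u i) x (\<phi> i) else \<phi> i)"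
    "l2_norm (if P then regular_rep (u i) x (\<phi> i) else \<phi> i) = 1" for P i
    by (auto simp: square_summable_regular_rep l2_norm_regular_rep u \<phi>_summable \<phi>_norm)
  have w_le: "cmod (w i) \<le> 1" for i
    unfolding w_def using Cauchy_Schwarz_l2[OF g(1) g(1)] by (simp only: g(2) mult_1)
  have w_defect: "cmod (1 - w i) = (if i \<in> K \<longleftrightarrow> i \<in> K' then 0 else coefficient_defect x i)" for i
  proof (cases "i \<in> K \<longleftrightarrow> i \<in> K'")
    case True
    then have "w i = 1"
      using g(2)[of "i \<in> K" i] by (simp add: w_def l2_inner_self)
    with True show ?thesis
      by simp
  next
    case False
    \<comment> \<open>Exchanging the arguments conjugates the coefficient and preserves its distance
      from 1.\<close>
    have "cmod (1 - l2_inner (\<phi> i) (regular_rep (u i) x (\<phi> i))) = coefficient_defect x i"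
      unfolding coefficient_defect_def l2_inner_commute[of "\<phi> i"]
      by (metis complex_cnj_diff complex_cnj_one complex_mod_cnj)
    with False show ?thesis
      by (auto simp: w_def coefficient_defect_def)
  qed
  have "cmod (1 - ?p) = cmod ((\<Prod>i=n..<n + d. 1) - ?p)"
    by simp
  also have "\<dots> \<le> (\<Sum>i=n..<n + d. cmod (1 - w i))"
    by (rule norm_prod_diff) (auto simp: w_le)
  finally have p: "cmod (1 - ?p) \<le> (\<Sum>i=n..<n + d. cmod (1 - w i))" .
  have "(l2_norm (\<lambda>xs. W K x (connect \<iota> n d \<psi>) xs - W K' x (connect \<iota> n d \<psi>) xs))\<^sup>2
      = 2 * (l2_norm \<psi>)\<^sup>2 * (1 - Re ?p)"
    using V_summable[OF W_closed[OF V]]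
    by (simp add: l2_norm_diff_power2 l2_norm_translate_factors connect_norm[OF \<psi>]
        connect_W_inner[OF \<psi> K] w_def algebra_simps del: of_real_power)
  also have "\<dots> \<le> 2 * (l2_norm \<psi>)\<^sup>2 * (\<Sum>i=n..<n + d. cmod (1 - w i))"
    using complex_Re_le_cmod[of "1 - ?p"] p by (intro mult_left_mono) auto
  finally show ?thesis
    by (simp add: w_defect)
qed

text \<open>The tail of the coefficient defects controls the error, uniformly in \<open>d\<close>
  and in both index sets.\<close>

lemma W_tail:
  assumes s: "s \<in> L" and e: "0 < e"
  obtains M where "\<And>n K K' d. \<lbrakk>M \<le> n; K \<inter> {..<n} = K' \<inter> {..<n}\<rbrakk> \<Longrightarrow>
    l2_norm (\<lambda>xs. W K x (connect \<iota> n d (s n)) xs - W K' x (connect \<iota> n d (s n)) xs) < e"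
proof -
  obtain B where B: "0 < B" "\<And>k. l2_norm (s k) \<le> B"
    using L_bounded[OF s] by blast
  \<comment> \<open>Chosen so that a tail below this value, multiplied by
    \<open>2 * B\<^sup>2\<close>, stays below \<open>e\<^sup>2\<close>.\<close>
  have "0 < e\<^sup>2 / (2 * B\<^sup>2)"
    using e B(1) by simp
  then obtain M where M: "\<And>m n. M \<le> m \<Longrightarrow> norm (\<Sum>i=m..<n. coefficient_defect x i) < e\<^sup>2 / (2 * B\<^sup>2)"
    using coefficients[of x] unfolding summable_Cauchy coefficient_defect_def by blast
  have "l2_norm (\<lambda>xs. W K x (connect \<iota> n d (s n)) xs - W K' x (connect \<iota> n d (s n)) xs) < e"
    if n: "M \<le> n" and K: "K \<inter> {..<n} = K' \<inter> {..<n}" for n K K' d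
  proof (rule power2_less_imp_less)
    have nn: "0 \<le> coefficient_defect x i" for i
      by (simp add: coefficient_defect_def)
    have "(l2_norm (\<lambda>xs. W K x (connect \<iota> n d (s n)) xs - W K' x (connect \<iota> n d (s n)) xs))\<^sup>2
        \<le> 2 * (l2_norm (s n))\<^sup>2 * (\<Sum>i=n..<n + d. if i \<in> K \<longleftrightarrow> i \<in> K' then 0 else coefficient_defect x i)"
      by (rule connect_W_diff[OF L_in_V[OF s] K])
    also have "\<dots> \<le> 2 * B\<^sup>2 * (\<Sum>i=n..<n + d. coefficient_defect x i)"
      using B(2) nn by (intro mult_mono power_mono sum_mono sum_nonneg) auto
    also have "\<dots> < e\<^sup>2"
      using M[OF n, of "n + d"] B(1) nn by (simp add: sum_nonneg field_simps)
    finally show "(l2_norm (\<lambda>xs. W K x (connect \<iota> n d (s n)) xs - W K' x (connect \<iota> n d (s n)) xs))\<^sup>2 < e\<^sup>2" .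
  qed (use e in simp)
  then show ?thesis
    using that by blast
qed

text \<open>Factors appended after the translation are left untranslated, so only the part of
  \<open>K\<close> below \<open>n\<close> survives.\<close>

lemma connect_W:
  assumes \<psi>: "\<psi> \<in> V n"
  shows "connect \<iota> n d (W K x \<psi>) = W (K \<inter> {..<n}) x (connect \<iota> n d \<psi>)"
proof (induction d)
  case 0
  show ?case
    using W_restrict[OF \<psi>, of K "K \<inter> {..<n}"] by simp
next
  case (Suc d)
  then show ?case
    by (simp add: W_append_factor[OF connect_closed[OF \<psi>]])
qed

text \<open>Translations do not commute with the embeddings in general. By \<open>connect_W\<close>
  the discrepancy is that between \<open>K\<close> and its part below \<open>n\<close>, which
  \<open>W_tail\<close> makes small; the rest is the Cauchy property of \<open>s\<close>.\<close>

lemma W_L: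
  assumes s: "s \<in> L"
  shows "(\<lambda>k. W K x (s k)) \<in> L"
  unfolding in_L_iff
proof (intro conjI allI impI)
  fix e :: real assume "0 < e"
  then have e: "0 < e / 2"
    by simp
  obtain M where M: "\<And>n K K' d. \<lbrakk>M \<le> n; K \<inter> {..<n} = K' \<inter> {..<n}\<rbrakk> \<Longrightarrow>
      l2_norm (\<lambda>xs. W K x (connect \<iota> n d (s n)) xs - W K' x (connect \<iota> n d (s n)) xs) < e / 2"
    using W_tail[OF s e] by blast
  obtain M' where M': "\<And>n d. M' \<le> n \<Longrightarrow> l2_norm (\<lambda>xs. connect \<iota> n d (s n) xs - s (n + d) xs) < e / 2"
    using L_Cauchy[OF s e] by blast
  have "l2_norm (\<lambda>xs. connect \<iota> n d (W K x (s n)) xs - W K x (s (n + d)) xs) < e"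
    if n: "max M M' \<le> n" for n d
  proof -
    have "l2_norm (\<lambda>xs. connect \<iota> n d (W K x (s n)) xs - W K x (s (n + d)) xs)
        \<le> l2_norm (\<lambda>xs. W (K \<inter> {..<n}) x (connect \<iota> n d (s n)) xs - W K x (connect \<iota> n d (s n)) xs)
          + l2_norm (\<lambda>xs. W K x (connect \<iota> n d (s n)) xs - W K x (s (n + d)) xs)"
      unfolding connect_W[OF L_in_V[OF s]]
      by (intro l2_norm_triangle3) (auto simp: square_summable_translate_factors
          L_summable[OF s] L_connect_summable[OF s])
    also have "\<dots> < e / 2 + e / 2"
      using n M[of n "K \<inter> {..<n}" K d] M'[of n d]
      by (intro add_strict_mono)
        (auto simp: l2_norm_translate_factors simp flip: translate_factors_diff)
    finally show ?thesis
      by simp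
  qed
  then show "\<exists>M. \<forall>n\<ge>M. \<forall>d. l2_norm (\<lambda>xs. connect \<iota> n d (W K x (s n)) xs - W K x (s (n + d)) xs) < e"
    by blast
qed (intro W_closed L_in_V s)

text \<open>Finite \<open>K\<close> give the partial tensor operators, and \<open>UNIV\<close> gives
  their strong limit.\<close>

definition limit_translation :: "nat set \<Rightarrow> 'g \<Rightarrow> (nat \<Rightarrow> 'g list \<Rightarrow> complex) set \<Rightarrow> (nat \<Rightarrow> 'g list \<Rightarrow> complex) set" where
  "limit_translation K x = limit_op (\<lambda>n. ell2 {xs. length xs = n}) \<iota> (\<lambda>k. W K x)"

lemma limit_translation_cls: "s \<in> L \<Longrightarrow> limit_translation K x (cls s) = cls (\<lambda>k. W K x (s k))"
  unfolding limit_translation_def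
  by (rule limit_op_cls) (auto intro: W_L simp: l2_norm_translate_factors simp flip: translate_factors_diff)

lemma partial_tensor_op_eq:
  assumes "finite J"
  shows "partial_tensor_op \<phi> (\<lambda>i. regular_rep (u i) x) J = limit_translation J x"
  unfolding partial_tensor_op_def limit_translation_def in_factors_regular_rep[OF assms]
  by (simp add: tensor_power_def[abs_def])

lemma bounded_limit_translation: "bounded_operator C (limit_translation K x)"
  unfolding bounded_operator_def
proof (intro conjI ballI allI exI)
  fix v w c assume "v \<in> vecs C"
  then obtain s where s: "s \<in> L" and v: "v = cls s"
    by (rule vecs_C_E)
  show "limit_translation K x v \<in> vecs C"
    using s W_L by (simp add: v limit_translation_cls cls_in_vecs)
  show "limit_translation K x (vscale C c v) = vscale C c (limit_translation K x v)"
    using s W_L by (simp add: v limit_translation_cls vscale_cls L_scale translate_factors_scale)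
  have "vnorm C (limit_translation K x v) = vnorm C v"
    using vnorm_cls[OF s] vnorm_cls[OF W_L[OF s, of K x]] s
    by (simp add: v limit_translation_cls l2_norm_translate_factors LIMSEQ_unique)
  then show "vnorm C (limit_translation K x v) \<le> 1 * vnorm C v"
    by simp
  assume "w \<in> vecs C"
  then obtain t where t: "t \<in> L" and w: "w = cls t"
    by (rule vecs_C_E)
  show "limit_translation K x (vadd C v w) = vadd C (limit_translation K x v) (limit_translation K x w)"
    using s t W_L by (simp add: v w limit_translation_cls vadd_cls L_add translate_factors_add)
qed

lemma inner_limit_translation:
  assumes "v \<in> vecs C" "w \<in> vecs C"
  shows "vinner C (limit_translation K x v) (limit_translation K x w) = vinner C v w"
proof -
  obtain s t where s: "s \<in> L" and t: "t \<in> L" and eq: "v = cls s" "w = cls t"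
    using assms by (metis vecs_C_E)
  show ?thesis
    using vinner_cls[OF s t] vinner_cls[OF W_L[OF s, of K x] W_L[OF t, of K x]] s t
    by (simp add: eq limit_translation_cls l2_inner_translate_factors LIMSEQ_unique)
qed

text \<open>At stage \<open>k\<close> the composition produces the partial product over indices
  below \<open>k\<close>; these scalars tend to \<open>p\<close> while the translated vectors stay
  bounded.\<close>

lemma limit_translation_compose:
  assumes p: "(\<lambda>n. \<Prod>i\<in>K \<inter> {..<n}. u i x y) \<longlonglongrightarrow> p" and v: "v \<in> vecs C"
  shows "limit_translation K x (limit_translation K y v) = vscale C p (limit_translation K (x + y) v)"
proof -
  obtain s where s: "s \<in> L" and eq: "v = cls s"
    using v by (rule vecs_C_E)
  let ?t = "\<lambda>k. W K (x + y) (s k)"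
  obtain B where B: "\<And>k. l2_norm (?t k) \<le> B"
    using L_bounded[OF W_L[OF s]] by blast
  have "(\<lambda>k. l2_norm (\<lambda>xs. W K x (W K y (s k)) xs - p * ?t k xs)) \<longlonglongrightarrow> 0"
  proof (rule tendsto_sandwich[OF _ _ tendsto_const])
    show "(\<lambda>k. cmod ((\<Prod>i\<in>K \<inter> {..<k}. u i x y) - p) * B) \<longlonglongrightarrow> 0"
      using tendsto_mult_right[OF tendsto_norm[OF LIM_zero[OF p]], of B] by simp
    have "l2_norm (\<lambda>xs. W K x (W K y (s k)) xs - p * ?t k xs)
        = cmod ((\<Prod>i\<in>K \<inter> {..<k}. u i x y) - p) * l2_norm (?t k)" for k
      unfolding W_compose[OF L_in_V[OF s]] left_diff_distrib[symmetric] by (rule l2_norm_scale)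
    then show "\<forall>\<^sub>F k in sequentially. l2_norm (\<lambda>xs. W K x (W K y (s k)) xs - p * ?t k xs)
        \<le> cmod ((\<Prod>i\<in>K \<inter> {..<k}. u i x y) - p) * B"
      by (simp add: B mult_left_mono)
  qed auto
  then have "(\<lambda>k. W K x (W K y (s k)), \<lambda>k xs. p * ?t k xs) \<in> R"
    using s by (simp add: in_R_iff W_L L_scale)
  from cls_eqI[OF this] show ?thesis
    using s by (simp add: eq limit_translation_cls W_L vscale_cls)
qed

lemma limit_translation_0: "v \<in> vecs C \<Longrightarrow> limit_translation K 0 v = v"
  by (elim vecs_C_E) (simp add: limit_translation_cls translate_factors_0)

lemma strong_limit_translation:
  "strong_limit C (partial_tensor_op \<phi> (\<lambda>i. regular_rep (u i) x)) (limit_translation UNIV x)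
    (finite_subsets_at_top UNIV)"
  unfolding strong_limit_def
proof
  fix v assume "v \<in> vecs C"
  then obtain s where s: "s \<in> L" and v: "v = cls s"
    by (rule vecs_C_E)
  show "((\<lambda>J. vdist C (partial_tensor_op \<phi> (\<lambda>i. regular_rep (u i) x) J v) (limit_translation UNIV x v))
      \<longlongrightarrow> 0) (finite_subsets_at_top UNIV)"
  proof (rule tendstoI)
    fix e :: real assume "0 < e"
    \<comment> \<open>Three errors below \<open>e / 4\<close> leave at most
      \<open>3 * (e / 4)\<close> in the limit, still strictly below \<open>e\<close>.\<close>
    then have e: "0 < e / 4"
      by simp
    obtain M0 where M0: "\<And>n K K' d. \<lbrakk>M0 \<le> n; K \<inter> {..<n} = K' \<inter> {..<n}\<rbrakk> \<Longrightarrow>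
        l2_norm (\<lambda>xs. W K x (connect \<iota> n d (s n)) xs - W K' x (connect \<iota> n d (s n)) xs) < e / 4"
      using W_tail[OF s e] by blast
    obtain M1 where M1: "\<And>n d. M1 \<le> n \<Longrightarrow> l2_norm (\<lambda>xs. connect \<iota> n d (s n) xs - s (n + d) xs) < e / 4"
      using L_Cauchy[OF s e] by blast
    define M where "M = max M0 M1"
    have upper: "vdist C (limit_translation J x v) (limit_translation UNIV x v) \<le> 3 * (e / 4)"
      if J: "{..<M} \<subseteq> J" for J
    proof (rule LIMSEQ_le_const2)
      show "(\<lambda>k. l2_norm (\<lambda>xs. W J x (s k) xs - W UNIV x (s k) xs))
          \<longlonglongrightarrow> vdist C (limit_translation J x v) (limit_translation UNIV x v)"
        using s by (simp add: v limit_translation_cls vdist_cls W_L)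
      have "l2_norm (\<lambda>xs. W J x (s k) xs - W UNIV x (s k) xs) \<le> 3 * (e / 4)" if "M \<le> k" for k
      proof -
        obtain d where k: "k = M + d"
          using le_Suc_ex[OF \<open>M \<le> k\<close>] by blast
        let ?c = "connect \<iota> M d (s M)"
        have sum: "square_summable (W K x (s k))" "square_summable (W K x ?c)" for K
          by (simp_all add: square_summable_translate_factors L_summable[OF s] L_connect_summable[OF s])
        have c: "l2_norm (\<lambda>xs. W K x ?c xs - W K x (s k) xs) < e / 4" for K
          using M1[of M d] by (simp add: k M_def l2_norm_translate_factors flip: translate_factors_diff)
        \<comment> \<open>Go from \<open>s k\<close> to the embedded vector \<open>s M\<close>,
          change \<open>J\<close> to \<open>UNIV\<close> there, and return. As \<open>J\<close>
          contains all indices below \<open>M\<close>, the tail estimate applies to the middle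
          distance.\<close>
        have "l2_norm (\<lambda>xs. W J x (s k) xs - W UNIV x (s k) xs)
            \<le> l2_norm (\<lambda>xs. W J x (s k) xs - W J x ?c xs) + l2_norm (\<lambda>xs. W J x ?c xs - W UNIV x (s k) xs)"
          by (intro l2_norm_triangle3 sum)
        also have "l2_norm (\<lambda>xs. W J x ?c xs - W UNIV x (s k) xs)
            \<le> l2_norm (\<lambda>xs. W J x ?c xs - W UNIV x ?c xs) + l2_norm (\<lambda>xs. W UNIV x ?c xs - W UNIV x (s k) xs)"
          by (intro l2_norm_triangle3 sum)
        also have "l2_norm (\<lambda>xs. W J x ?c xs - W UNIV x ?c xs) < e / 4"
          using J by (intro M0) (auto simp: M_def)
        finally show ?thesis
          using c[of J] c[of UNIV] l2_norm_minus_commute[of "W J x (s k)" "W J x ?c"] by linarith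
      qed
      then show "\<exists>N. \<forall>k\<ge>N. l2_norm (\<lambda>xs. W J x (s k) xs - W UNIV x (s k) xs) \<le> 3 * (e / 4)"
        by blast
    qed
    have lower: "0 \<le> vdist C (limit_translation J x v) (limit_translation UNIV x v)" for J
      using s by (intro vdist_nonneg) (simp_all add: v limit_translation_cls cls_in_vecs W_L)
    have "dist (vdist C (limit_translation J x v) (limit_translation UNIV x v)) 0 < e"
      if "{..<M} \<subseteq> J" for J
      using upper[OF that] lower[of J] \<open>0 < e\<close> by (simp add: dist_real_def)
    then show "\<forall>\<^sub>F J in finite_subsets_at_top UNIV.
        dist (vdist C (partial_tensor_op \<phi> (\<lambda>i. regular_rep (u i) x) J v) (limit_translation UNIV x v)) 0 < e"
      unfolding eventually_finite_subsets_at_top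
      by (intro exI[of _ "{..<M}"]) (simp add: partial_tensor_op_eq)
  qed
qed

lemma is_tensor_op_limit_translation:
  "is_tensor_op \<phi> (\<lambda>i. regular_rep (u i) x) (limit_translation UNIV x)"
  by (simp add: is_tensor_op_def inf_tensor_eq bounded_limit_translation strong_limit_translation)

lemma tensor_op_exists_regular_rep: "tensor_op_exists \<phi> (\<lambda>i. regular_rep (u i) x)"
  unfolding tensor_op_exists_def using is_tensor_op_limit_translation by blast

lemma tensor_op_eq:
  assumes v: "v \<in> vecs C"
  shows "tensor_op \<phi> (\<lambda>i. regular_rep (u i) x) v = limit_translation UNIV x v"
proof -
  \<comment> \<open>\<open>T\<close> maps the carrier to itself for every \<open>J\<close>, finite
    or not, as \<open>strong_limit_unique\<close> requires. It agrees with the partial tensor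
    operators on finite \<open>J\<close>, hence eventually along the net.\<close>
  define T where "T J = limit_translation J x" for J
  have lim: "strong_limit C T S (finite_subsets_at_top UNIV)"
    if "strong_limit C (partial_tensor_op \<phi> (\<lambda>i. regular_rep (u i) x)) S (finite_subsets_at_top UNIV)" for S
    unfolding strong_limit_def
  proof
    fix v assume "v \<in> vecs C"
    with that have "((\<lambda>J. vdist C (partial_tensor_op \<phi> (\<lambda>i. regular_rep (u i) x) J v) (S v)) \<longlongrightarrow> 0)
        (finite_subsets_at_top UNIV)"
      by (simp add: strong_limit_def)
    then show "((\<lambda>J. vdist C (T J v) (S v)) \<longlongrightarrow> 0) (finite_subsets_at_top UNIV)"
      by (rule Lim_transform_eventually)
        (auto simp: eventually_finite_subsets_at_top partial_tensor_op_eq T_def)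
  qed
  have "is_tensor_op \<phi> (\<lambda>i. regular_rep (u i) x) (tensor_op \<phi> (\<lambda>i. regular_rep (u i) x))"
    using tensor_op_exists_regular_rep unfolding tensor_op_def tensor_op_exists_def by (rule someI_ex)
  then have "bounded_operator C (tensor_op \<phi> (\<lambda>i. regular_rep (u i) x))"
    "strong_limit C T (tensor_op \<phi> (\<lambda>i. regular_rep (u i) x)) (finite_subsets_at_top UNIV)"
    by (simp_all add: is_tensor_op_def inf_tensor_eq lim)
  then show ?thesis
    using lim[OF strong_limit_translation] v bounded_limit_translation
    by (intro strong_limit_unique[where T = T and \<F> = "finite_subsets_at_top UNIV"])
      (auto simp: T_def bounded_operator_def)
qed

theorem projective_unitary_rep_tensor_op:
  assumes prod: "\<And>x y. infprod_exists (\<lambda>i. u i x y)"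
  shows "projective_unitary_rep (inf_tensor \<phi>) (\<lambda>x. tensor_op \<phi> (\<lambda>i. regular_rep (u i) x))
    (\<lambda>x y. infprod (\<lambda>i. u i x y))"
proof -
  let ?p = "\<lambda>x y. infprod (\<lambda>i. u i x y)"
  have net: "((\<lambda>J. \<Prod>i\<in>J. u i x y) \<longlongrightarrow> ?p x y) (finite_subsets_at_top UNIV)" for x y
  proof -
    obtain p where "((\<lambda>J. \<Prod>i\<in>J. u i x y) \<longlongrightarrow> p) (finite_subsets_at_top UNIV)"
      using prod[of x y] unfolding infprod_exists_def by blast
    then show ?thesis
      unfolding infprod_def using tendsto_Lim finite_subsets_at_top_neq_bot by metis
  qed
  \<comment> \<open>The initial segments form a cofinal sequence of finite sets.\<close>
  have seq: "(\<lambda>n. \<Prod>i\<in>UNIV \<inter> {..<n}. u i x y) \<longlonglongrightarrow> ?p x y" for x y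
    using filterlim_compose[OF net filterlim_lessThan_at_top] by simp
  have cocycle: "?p \<in> cocycles"
  proof -
    have "cmod (?p x y) = 1" for x y
      using tendsto_norm[OF net[of x y]]
      by (simp add: prod_norm[symmetric] cmod_cocycle[OF u] tendsto_const_iff)
    moreover have "?p x y * ?p (x + y) z = ?p y z * ?p x (y + z)" for x y z
    proof -
      have "u i x y * u i (x + y) z = u i y z * u i x (y + z)" for i
        using u[of i] by (simp add: cocycles_def)
      then have "(\<lambda>J. (\<Prod>i\<in>J. u i x y) * (\<Prod>i\<in>J. u i (x + y) z))
          = (\<lambda>J. (\<Prod>i\<in>J. u i y z) * (\<Prod>i\<in>J. u i x (y + z)))"
        by (simp add: prod.distrib[symmetric])
      then show ?thesis
        using tendsto_mult[OF net[of x y] net[of "x + y" z]] tendsto_mult[OF net[of y z] net[of x "y + z"]]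
        by (simp add: tendsto_unique[OF finite_subsets_at_top_neq_bot])
    qed
    moreover have "?p x 0 = 1" "?p 0 x = 1" for x
      using net[of x 0] net[of 0 x] u by (simp_all add: cocycles_def tendsto_const_iff)
    ultimately show ?thesis
      by (simp add: cocycles_def)
  qed
  let ?U = "\<lambda>x. tensor_op \<phi> (\<lambda>i. regular_rep (u i) x)"
  have closed: "limit_translation UNIV x v \<in> vecs C" if "v \<in> vecs C" for x v
    using bounded_limit_translation that by (simp add: bounded_operator_def)
  have mult: "limit_translation UNIV x (limit_translation UNIV y v)
      = vscale C (?p x y) (limit_translation UNIV (x + y) v)" if "v \<in> vecs C" for x y v
    by (rule limit_translation_compose[OF seq that])
  have "unitary_operator C (?U x)" for x
    unfolding unitary_operator_def
  proof (intro conjI ballI)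
    show "bounded_operator C (?U x)"
      using bounded_limit_translation[of UNIV x]
      by (simp add: bounded_operator_def tensor_op_eq vadd_closed vscale_closed)
    show "vinner C (?U x v) (?U x w) = vinner C v w" if "v \<in> vecs C" "w \<in> vecs C" for v w
      using that by (simp add: tensor_op_eq inner_limit_translation)
    show "?U x ` vecs C = vecs C"
    proof
      show "?U x ` vecs C \<subseteq> vecs C"
        using closed by (auto simp: tensor_op_eq)
      show "vecs C \<subseteq> ?U x ` vecs C"
      proof
        fix v assume v: "v \<in> vecs C"
        have ne: "?p x (- x) \<noteq> 0"
          using cmod_cocycle[OF cocycle, of x "- x"] by auto
        \<comment> \<open>A preimage of \<open>v\<close>: translating by \<open>- x\<close> and then
          by \<open>x\<close> multiplies \<open>v\<close> by \<open>?p x (- x)\<close>, which has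
          modulus 1 and is divided out.\<close>
        define w where "w = vscale C (1 / ?p x (- x)) (limit_translation UNIV (- x) v)"
        have w: "w \<in> vecs C"
          by (simp add: w_def vscale_closed closed v)
        have "?U x w = vscale C (1 / ?p x (- x)) (limit_translation UNIV x (limit_translation UNIV (- x) v))"
          using bounded_limit_translation[of UNIV x] w closed[OF v]
          by (simp add: tensor_op_eq w_def bounded_operator_def)
        also have "\<dots> = vscale C (1 / ?p x (- x)) (vscale C (?p x (- x)) v)"
          by (simp add: mult v limit_translation_0)
        also have "\<dots> = v"
          using v by (rule vecs_C_E) (simp add: vscale_cls L_scale ne)
        finally show "v \<in> ?U x ` vecs C"
          using w by auto
      qed
    qed
  qed
  moreover have "?U x (?U y v) = vscale C (?p x y) (?U (x + y) v)" if "v \<in> vecs C" for x y v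
    using that by (simp add: tensor_op_eq closed mult)
  ultimately show ?thesis
    by (simp add: projective_unitary_rep_def cocycle inf_tensor_eq)
qed

end

section \<open>Infinite products of phases\<close>

text \<open>Absolute summability makes the sums of phases converge along finite sets, and the
  exponential is continuous.\<close>

lemma infprod_exists_exp:
  assumes "summable (\<lambda>i. \<bar>\<theta> i\<bar>)"
  shows "infprod_exists (\<lambda>i. exp (\<i> * complex_of_real (\<theta> i)))"
proof -
  have "\<theta> summable_on UNIV"
    using assms by (intro norm_summable_imp_summable_on) simp
  then have "(sum \<theta> \<longlongrightarrow> infsum \<theta> UNIV) (finite_subsets_at_top UNIV)"
    using has_sum_infsum unfolding has_sum_def by blast
  then have "((\<lambda>J. exp (\<i> * complex_of_real (sum \<theta> J))) \<longlongrightarrow> exp (\<i> * complex_of_real (infsum \<theta> UNIV)))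
      (finite_subsets_at_top UNIV)"
    by (intro tendsto_intros)
  moreover have "\<forall>\<^sub>F J in finite_subsets_at_top UNIV.
      exp (\<i> * complex_of_real (sum \<theta> J)) = (\<Prod>i\<in>J. exp (\<i> * complex_of_real (\<theta> i)))"
    by (rule eventually_finite_subsets_at_top_weakI) (simp add: sum_distrib_left exp_sum)
  ultimately show ?thesis
    unfolding infprod_exists_def by (blast intro: Lim_transform_eventually)
qed

text \<open>The chord from 1 to the point of angle \<open>t\<close> has length
  \<open>2 * \<bar>sin (t / 2)\<bar>\<close>, which is 1 at angle \<open>pi / 3\<close>; the sine is
  increasing on the range of \<open>t / 2\<close>.\<close>

lemma abs_less_pi_third:
  assumes "\<bar>t\<bar> \<le> pi" and "cmod (exp (\<i> * complex_of_real t) - 1) < 1"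
  shows "\<bar>t\<bar> < pi / 3"
proof -
  have "sin \<bar>t / 2\<bar> \<le> \<bar>sin (t / 2)\<bar>"
    by (cases "0 \<le> t") (auto simp: abs_if)
  also have "\<dots> < sin (pi / 6)"
    using assms(2) by (simp add: dist_exp_i_1 sin_30)
  finally have "\<bar>t / 2\<bar> < pi / 6"
    using assms(1) by (subst (asm) sin_mono_less_eq) auto
  then show ?thesis
    by simp
qed

text \<open>Once the products over finite sets of remaining indices stay within distance 1 of 1, the sum
  of the remaining phases of one sign, built up in steps below \<open>\<pi>/3\<close>, cannot leave \<open>[0, \<pi>/3)\<close>.\<close>
lemma phase_sum_less:
  assumes "finite K" and "\<And>i. i \<in> K \<Longrightarrow> \<bar>\<theta> i\<bar> \<le> pi"
    and "\<And>K'. K' \<subseteq> K \<Longrightarrow> cmod (exp (\<i> * complex_of_real (sum \<theta> K')) - 1) < 1"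
    and "\<And>i. i \<in> K \<Longrightarrow> 0 \<le> \<theta> i"
  shows "sum \<theta> K < pi / 3"
  using assms
proof (induction K rule: finite_induct)
  case (insert i K)
  have "cmod (exp (\<i> * complex_of_real (sum \<theta> {i})) - 1) < 1"
    by (rule insert.prems(2)) simp
  then have "\<bar>\<theta> i\<bar> < pi / 3"
    using insert.prems(1)[of i] by (intro abs_less_pi_third) auto
  moreover have "sum \<theta> K < pi / 3"
    using insert.prems by (intro insert.IH) auto
  moreover have "0 \<le> sum \<theta> K" "0 \<le> \<theta> i"
    using insert.prems(3) by (auto intro: sum_nonneg)
  \<comment> \<open>Both parts are below \<open>pi / 3\<close>, so the enlarged sum is still within
    \<open>pi\<close>, where the chord bound applies again.\<close>
  ultimately have "\<bar>sum \<theta> (insert i K)\<bar> \<le> pi"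
    using insert.hyps by simp
  then show ?case
    using abs_less_pi_third[OF _ insert.prems(2)[of "insert i K"]] by simp
qed simp

lemma infprod_exists_expD:
  assumes \<theta>: "\<And>i. \<bar>\<theta> i\<bar> \<le> pi" and prod: "infprod_exists (\<lambda>i. exp (\<i> * complex_of_real (\<theta> i)))"
  shows "summable (\<lambda>i. \<bar>\<theta> i\<bar>)"
proof -
  let ?P = "\<lambda>J. \<Prod>i\<in>J. exp (\<i> * complex_of_real (\<theta> i))"
  obtain p where "(?P \<longlongrightarrow> p) (finite_subsets_at_top UNIV)"
    using prod unfolding infprod_exists_def by blast
  then have "\<forall>\<^sub>F J in finite_subsets_at_top UNIV. dist (?P J) p < 1 / 2"
    by (rule tendstoD) simp
  then obtain J0 where fin: "finite J0"
    and J0: "\<And>J. \<lbrakk>finite J; J0 \<subseteq> J\<rbrakk> \<Longrightarrow> dist (?P J) p < 1 / 2"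
    by (auto simp: eventually_finite_subsets_at_top)
  \<comment> \<open>Two products over sets containing \<open>J0\<close> differ by less than
    \<open>1 / 2 + 1 / 2\<close>; dividing by the product over \<open>J0\<close>, of modulus 1,
    isolates the product over \<open>K\<close>.\<close>
  have near: "cmod (exp (\<i> * complex_of_real (sum \<theta> K)) - 1) < 1" if K: "finite K" "J0 \<inter> K = {}" for K
  proof -
    have "cmod (?P J0) = 1"
      by (simp add: prod_norm[symmetric])
    then have "cmod (exp (\<i> * complex_of_real (sum \<theta> K)) - 1) = cmod (?P J0) * cmod (?P K - 1)"
      using K by (simp add: sum_distrib_left exp_sum)
    also have "\<dots> = dist (?P (J0 \<union> K)) (?P J0)"
      using K fin by (simp add: prod.union_disjoint dist_norm right_diff_distrib flip: norm_mult)
    also have "\<dots> \<le> dist (?P (J0 \<union> K)) p + dist (?P J0) p"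
      by (rule dist_triangle2)
    also have "\<dots> < 1"
      using J0[of "J0 \<union> K"] J0[of J0] K fin by simp
    finally show ?thesis .
  qed
  show ?thesis
  proof (rule summableI_nonneg_bounded)
    fix n
    let ?A = "{i \<in> {..<n} - J0. 0 \<le> \<theta> i}" and ?B = "{i \<in> {..<n} - J0. \<theta> i < 0}"
    have near_n: "cmod (exp (\<i> * complex_of_real (sum \<theta> K)) - 1) < 1" if "K \<subseteq> {..<n} - J0" for K
    proof (rule near)
      show "finite K"
        by (rule finite_subset[OF that]) simp
    qed (use that in blast)
    have A: "sum \<theta> ?A < pi / 3"
    proof (rule phase_sum_less)
      show "cmod (exp (\<i> * complex_of_real (sum \<theta> K)) - 1) < 1" if "K \<subseteq> ?A" for K
        by (rule near_n) (use that in blast)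
    qed (simp_all add: \<theta>[unfolded abs_le_iff])
    \<comment> \<open>Negating all phases conjugates the product and leaves its distance from 1
      unchanged.\<close>
    have near_B: "cmod (exp (\<i> * complex_of_real (sum (\<lambda>i. - \<theta> i) K)) - 1) < 1" if "K \<subseteq> ?B" for K
    proof -
      have "cmod (exp (\<i> * complex_of_real (sum \<theta> K)) - 1) < 1"
        by (rule near_n) (use that in blast)
      then show ?thesis
        using dist_exp_i_1[of "sum \<theta> K"] dist_exp_i_1[of "- sum \<theta> K"] by (simp add: sum_negf)
    qed
    have B: "sum (\<lambda>i. - \<theta> i) ?B < pi / 3"
      by (rule phase_sum_less[OF _ _ near_B]) (simp_all add: \<theta>[unfolded abs_le_iff])
    \<comment> \<open>The exceptional set \<open>J0\<close> contributes a fixed amount, and the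
      other indices split by sign into two sums below \<open>pi / 3\<close>.\<close>
    have "(\<Sum>i<n. \<bar>\<theta> i\<bar>) \<le> (\<Sum>i\<in>J0 \<union> (?A \<union> ?B). \<bar>\<theta> i\<bar>)"
      using fin by (intro sum_mono2) auto
    also have "\<dots> = (\<Sum>i\<in>J0. \<bar>\<theta> i\<bar>) + ((\<Sum>i\<in>?A. \<bar>\<theta> i\<bar>) + (\<Sum>i\<in>?B. \<bar>\<theta> i\<bar>))"
      using fin by (subst sum.union_disjoint; (subst sum.union_disjoint)?) auto
    also have "(\<Sum>i\<in>?A. \<bar>\<theta> i\<bar>) = sum \<theta> ?A"
      by (rule sum.cong) auto
    also have "(\<Sum>i\<in>?B. \<bar>\<theta> i\<bar>) = sum (\<lambda>i. - \<theta> i) ?B"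
      by (rule sum.cong) auto
    finally show "(\<Sum>i<n. \<bar>\<theta> i\<bar>) \<le> (\<Sum>i\<in>J0. \<bar>\<theta> i\<bar>) + 2 * (pi / 3)"
      using A B by linarith
  qed simp
qed

section \<open>Phases defined by a matrix\<close>

lemma abs_le_max_entry: "\<bar>A $ k $ l\<bar> \<le> max_entry A"
proof -
  have "(\<lambda>(k, l). \<bar>A $ k $ l\<bar>) (k, l) \<in> range (\<lambda>(k, l). \<bar>A $ k $ l\<bar>)"
    by (rule rangeI)
  then show ?thesis
    unfolding max_entry_def by (intro Max_ge) auto
qed

lemma max_entry_nonneg: "0 \<le> max_entry A"
  using abs_le_max_entry[of A undefined undefined] by linarith

text \<open>Serves to deduce summability of the maximal entries from that of each entry
  separately.\<close>

lemma max_entry_le_sum: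
  fixes A :: "real ^ 'n ^ 'n"
  shows "max_entry A \<le> (\<Sum>k\<in>UNIV. \<Sum>l\<in>UNIV. \<bar>A $ k $ l\<bar>)"
proof -
  have "max_entry A \<in> range (\<lambda>(k, l). \<bar>A $ k $ l\<bar>)"
    unfolding max_entry_def by (rule Max_in) auto
  then obtain k l where "max_entry A = \<bar>A $ k $ l\<bar>"
    by auto
  also have "\<dots> \<le> (\<Sum>l\<in>UNIV. \<bar>A $ k $ l\<bar>)"
    by (rule member_le_sum) auto
  also have "\<dots> \<le> (\<Sum>k\<in>UNIV. \<Sum>l\<in>UNIV. \<bar>A $ k $ l\<bar>)"
    by (rule member_le_sum) (auto intro: sum_nonneg)
  finally show ?thesis .
qed

definition l1_norm :: "int ^ 'n \<Rightarrow> real" where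
  "l1_norm x = (\<Sum>j\<in>UNIV. \<bar>real_of_int (x $ j)\<bar>)"

lemma l1_norm_nonneg: "0 \<le> l1_norm x"
  by (simp add: l1_norm_def sum_nonneg)

lemma abs_phase_le:
  "\<bar>real_vec x \<bullet> (A *v real_vec y)\<bar> \<le> max_entry A * l1_norm x * l1_norm y"
proof -
  have "real_vec x \<bullet> (A *v real_vec y)
      = (\<Sum>k\<in>UNIV. \<Sum>l\<in>UNIV. real_of_int (x $ k) * (A $ k $ l * real_of_int (y $ l)))"
    by (simp add: inner_vec_def matrix_vector_mult_def real_vec_def sum_distrib_left)
  also have "\<bar>\<dots>\<bar> \<le> (\<Sum>k\<in>UNIV. \<Sum>l\<in>UNIV. \<bar>real_of_int (x $ k) * (A $ k $ l * real_of_int (y $ l))\<bar>)"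
    by (rule order_trans[OF sum_abs sum_mono]) (rule sum_abs)
  also have "\<dots> \<le> (\<Sum>k\<in>UNIV. \<Sum>l\<in>UNIV. \<bar>real_of_int (x $ k)\<bar> * (max_entry A * \<bar>real_of_int (y $ l)\<bar>))"
    unfolding abs_mult by (intro sum_mono mult_left_mono mult_right_mono abs_le_max_entry) auto
  also have "\<dots> = max_entry A * l1_norm x * l1_norm y"
    by (simp add: l1_norm_def sum_product sum_distrib_left mult_ac)
  finally show ?thesis .
qed

text \<open>A chord is at most as long as its arc.\<close>

lemma cmod_u_mat_minus_1_le: "cmod (1 - u_mat A x y) \<le> max_entry A * l1_norm x * l1_norm y"
proof -
  have "cmod (1 - u_mat A x y) = 2 * \<bar>sin ((real_vec x \<bullet> (A *v real_vec y)) / 2)\<bar>"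
    unfolding u_mat_def dist_exp_i_1[symmetric] by (rule norm_minus_commute)
  also have "\<dots> \<le> \<bar>real_vec x \<bullet> (A *v real_vec y)\<bar>"
    using abs_sin_x_le_abs_x[of "(real_vec x \<bullet> (A *v real_vec y)) / 2"] by simp
  finally show ?thesis
    using abs_phase_le[of x A y] by linarith
qed

lemma infprod_exists_u_mat_iff:
  fixes A :: "nat \<Rightarrow> real ^ 'n ^ 'n"
  assumes "\<And>i k l. A i $ k $ l \<in> {- pi <.. pi}"
  shows "(\<forall>x y. infprod_exists (\<lambda>i. u_mat (A i) x y)) \<longleftrightarrow> summable (\<lambda>i. max_entry (A i))"
proof
  assume prod: "\<forall>x y. infprod_exists (\<lambda>i. u_mat (A i) x y)"
  have "summable (\<lambda>i. \<bar>A i $ k $ l\<bar>)" for k l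
  proof (rule infprod_exists_expD)
    show "\<bar>A i $ k $ l\<bar> \<le> pi" for i
      using assms[of i k l] by auto
    \<comment> \<open>Standard basis vectors turn the bilinear phase into a single matrix entry,
      whose range is the one required by \<open>infprod_exists_expD\<close>.\<close>
    have "real_vec (axis j 1) = axis j 1" for j :: 'n
      by (simp add: real_vec_def axis_def vec_eq_iff)
    then have "u_mat (A i) (axis k 1) (axis l 1) = exp (\<i> * complex_of_real (A i $ k $ l))" for i
      by (simp add: u_mat_def matrix_vector_mult_basis inner_axis' column_def)
    then show "infprod_exists (\<lambda>i. exp (\<i> * complex_of_real (A i $ k $ l)))"
      using prod[rule_format, of "axis k 1" "axis l 1"] by simp
  qed
  then have "summable (\<lambda>i. \<Sum>k\<in>UNIV. \<Sum>l\<in>UNIV. \<bar>A i $ k $ l\<bar>)"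
    by (intro summable_sum)
  then show "summable (\<lambda>i. max_entry (A i))"
    by (rule summable_comparison_test'[where N = 0]) (simp add: max_entry_nonneg max_entry_le_sum)
next
  assume sum: "summable (\<lambda>i. max_entry (A i))"
  show "\<forall>x y. infprod_exists (\<lambda>i. u_mat (A i) x y)"
    unfolding u_mat_def
  proof (intro allI infprod_exists_exp)
    fix x y :: "int ^ 'n"
    have "summable (\<lambda>i. max_entry (A i) * (l1_norm x * l1_norm y))"
      by (rule summable_mult2[OF sum])
    then show "summable (\<lambda>i. \<bar>real_vec x \<bullet> (A i *v real_vec y)\<bar>)"
      by (rule summable_comparison_test'[where N = 0]) (use abs_phase_le in \<open>simp add: mult.assoc\<close>)
  qed
qed

section \<open>Cubes in \<open>\<int>\<^sup>N\<close>\<close>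

text \<open>Vectors in a box are functions choosing a value from each interval; \<open>nat\<close>
  gives 0 when an interval is empty.\<close>

lemma
  fixes lo hi :: "'n::finite \<Rightarrow> int"
  shows finite_int_box: "finite {x :: int ^ 'n. \<forall>j. lo j \<le> x $ j \<and> x $ j \<le> hi j}" (is "finite ?B")
    and card_int_box: "card {x :: int ^ 'n. \<forall>j. lo j \<le> x $ j \<and> x $ j \<le> hi j}
      = (\<Prod>j\<in>UNIV. nat (hi j - lo j + 1))"
proof -
  have "bij_betw vec_nth ?B (PiE UNIV (\<lambda>j. {lo j..hi j}))"
  proof (rule bij_betw_imageI)
    show "inj_on vec_nth ?B"
      by (simp add: inj_on_def vec_nth_inject)
    show "vec_nth ` ?B = PiE UNIV (\<lambda>j. {lo j..hi j})"
    proof (intro equalityI subsetI)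
      fix f assume "f \<in> PiE UNIV (\<lambda>j. {lo j..hi j})"
      then have "vec_lambda f \<in> ?B"
        by (simp add: PiE_iff)
      then show "f \<in> vec_nth ` ?B"
        by (intro image_eqI[of _ _ "vec_lambda f"]) (simp_all add: vec_lambda_inverse)
    qed auto
  qed
  then have "finite ?B = finite (PiE UNIV (\<lambda>j. {lo j..hi j}))"
    and "card ?B = card (PiE UNIV (\<lambda>j. {lo j..hi j}))"
    by (rule bij_betw_finite, rule bij_betw_same_card)
  then show "finite ?B" and "card ?B = (\<Prod>j\<in>UNIV. nat (hi j - lo j + 1))"
    by (simp_all add: finite_PiE card_PiE algebra_simps)
qed

definition cube :: "nat \<Rightarrow> (int ^ 'n) set" where
  "cube m = {x. \<forall>j. 0 \<le> x $ j \<and> x $ j \<le> int m}"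

lemma finite_cube: "finite (cube m)"
  unfolding cube_def using finite_int_box[of "\<lambda>_. 0" "\<lambda>_. int m"] by simp

lemma cube_nonempty: "cube m \<noteq> {}"
  by (auto simp: cube_def intro!: exI[of _ 0])

lemma card_cube: "card (cube m :: (int ^ 'n) set) = (m + 1) ^ CARD('n)"
  unfolding cube_def using card_int_box[of "\<lambda>_. 0" "\<lambda>_. int m"] by (simp add: nat_add_distrib)

lemma card_cube_pos: "0 < card (cube m)"
  by (simp add: card_gt_0_iff finite_cube cube_nonempty)

text \<open>A cube meets its translate in a box whose side in direction \<open>j\<close> has
  \<open>m + 1 - \<bar>x $ j\<bar>\<close> points, or none if this number is negative.\<close>

lemma overlap_cube:
  fixes x :: "int ^ 'n"
  shows "overlap (cube m) x = (\<Prod>j\<in>UNIV. max 0 (1 - \<bar>real_of_int (x $ j)\<bar> / (real m + 1)))"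
proof -
  have mem: "y \<in> (+) x ` cube m \<longleftrightarrow> (\<forall>j. x $ j \<le> y $ j \<and> y $ j \<le> int m + x $ j)" for y :: "int ^ 'n"
  proof
    assume "\<forall>j. x $ j \<le> y $ j \<and> y $ j \<le> int m + x $ j"
    then have "y - x \<in> cube m"
      by (auto simp: cube_def algebra_simps)
    then show "y \<in> (+) x ` cube m"
      by (intro image_eqI[of _ _ "y - x"]) auto
  qed (auto simp: cube_def)
  have "cube m \<inter> (+) x ` cube m
      = {y. \<forall>j. max 0 (x $ j) \<le> y $ j \<and> y $ j \<le> min (int m) (int m + x $ j)}"
    by (auto simp: mem) (auto simp: cube_def)
  then have "card (cube m \<inter> (+) x ` cube m)
      = (\<Prod>j\<in>UNIV. nat (min (int m) (int m + x $ j) - max 0 (x $ j) + 1))"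
    by (simp only: card_int_box)
  moreover have "real (nat (min (int m) (int m + a) - max 0 a + 1)) / (real m + 1)
      = max 0 (1 - \<bar>real_of_int a\<bar> / (real m + 1))" for a :: int
  proof -
    have "min (int m) (int m + a) - max 0 a + 1 = int m + 1 - \<bar>a\<bar>"
      by auto
    moreover have "1 - \<bar>real_of_int a\<bar> / (real m + 1) = (real m + 1 - \<bar>real_of_int a\<bar>) / (real m + 1)"
      by (simp add: diff_divide_distrib)
    moreover have "real (nat (int m + 1 - \<bar>a\<bar>)) = max 0 (real m + 1 - \<bar>real_of_int a\<bar>)"
      by linarith
    ultimately show ?thesis
      by (simp only: max_def zero_le_divide_iff) (auto simp: max_def)
  qed
  moreover have "real (card (cube m :: (int ^ 'n) set)) = (\<Prod>j\<in>(UNIV :: 'n set). real m + 1)"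
    by (simp add: card_cube add.commute)
  ultimately show ?thesis
    unfolding overlap_def by (simp add: prod_dividef[symmetric] del: prod_constant)
qed

text \<open>All factors lie in \<open>[0, 1]\<close>, so the defect of the product is at most the
  sum of the defects of its factors.\<close>

lemma abs_1_minus_overlap_cube_le: "\<bar>1 - overlap (cube m) x\<bar> \<le> l1_norm x / (real m + 1)"
proof -
  let ?t = "\<lambda>j. \<bar>real_of_int (x $ j)\<bar> / (real m + 1)"
  have "norm ((\<Prod>j\<in>(UNIV :: 'a set). 1) - (\<Prod>j\<in>UNIV. max 0 (1 - ?t j)))
      \<le> (\<Sum>j\<in>UNIV. norm (1 - max 0 (1 - ?t j)))"
    by (rule norm_prod_diff) auto
  also have "\<dots> \<le> (\<Sum>j\<in>UNIV. ?t j)"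
    by (rule sum_mono) (auto simp: max_def abs_if)
  finally show ?thesis
    by (simp add: overlap_cube l1_norm_def sum_divide_distrib)
qed

text \<open>A unit vector already detects the rate \<open>1 / (m + 1)\<close>; this gives the
  necessity of the growth conditions on \<open>m\<close>.\<close>

lemma overlap_cube_axis: "overlap (cube m) (axis k 1) = 1 - 1 / (real m + 1)"
proof -
  have "max 0 (1 - 1 / (real m + 1)) = 1 - 1 / (real m + 1)"
    by simp
  then have "overlap (cube m) (axis k 1) = (\<Prod>j\<in>UNIV. if j = k then 1 - 1 / (real m + 1) else 1)"
    unfolding overlap_cube by (intro prod.cong) (auto simp: axis_def)
  then show ?thesis
    by simp
qed

lemma F_sequence_cube_iff:
  "F_sequence (\<lambda>i. cube (m i) :: (int ^ 'n) set) \<longleftrightarrow> filterlim m at_top sequentially"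
proof
  assume "F_sequence (\<lambda>i. cube (m i) :: (int ^ 'n) set)"
  then have "(\<lambda>i. overlap (cube (m i)) (axis undefined 1 :: int ^ 'n)) \<longlonglongrightarrow> 1"
    by (simp add: F_sequence_def)
  then have "(\<lambda>i. 1 - (1 - 1 / (real (m i) + 1))) \<longlonglongrightarrow> 1 - 1"
    unfolding overlap_cube_axis by (intro tendsto_diff tendsto_const)
  then have "(\<lambda>i. inverse (real (m i) + 1)) \<longlonglongrightarrow> 0"
    by (simp add: inverse_eq_divide)
  then have "filterlim (\<lambda>i. inverse (inverse (real (m i) + 1))) at_top sequentially"
    by (rule filterlim_inverse_at_top) (simp add: add_pos_nonneg add_nonneg_pos)
  then have "filterlim (\<lambda>i. - 1 + (real (m i) + 1)) at_top sequentially"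
    by (intro filterlim_tendsto_add_at_top[OF tendsto_const]) simp
  then show "filterlim m at_top sequentially"
    by (simp add: filterlim_sequentially_iff_filterlim_real)
next
  assume m: "filterlim m at_top sequentially"
  have "(\<lambda>i. overlap (cube (m i)) x) \<longlonglongrightarrow> 1" for x :: "int ^ 'n"
  proof -
    have "filterlim (\<lambda>i. 1 + real (m i)) at_top sequentially"
      using m by (intro filterlim_tendsto_add_at_top[OF tendsto_const])
        (simp add: filterlim_sequentially_iff_filterlim_real)
    from tendsto_mult_right[OF tendsto_inverse_0_at_top[OF this], of "l1_norm x"]
    have "(\<lambda>i. l1_norm x / (real (m i) + 1)) \<longlonglongrightarrow> 0"
      by (simp add: field_simps)
    then have "(\<lambda>i. overlap (cube (m i)) x - 1) \<longlonglongrightarrow> 0"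
      by (rule Lim_null_comparison[rotated])
        (simp add: abs_1_minus_overlap_cube_le abs_minus_commute[of _ 1])
    then show ?thesis
      by (simp add: LIM_zero_iff)
  qed
  then show "F_sequence (\<lambda>i. cube (m i) :: (int ^ 'n) set)"
    by (simp add: F_sequence_def finite_cube cube_nonempty)
qed

text \<open>Serves both the criterion for \<open>sigmaF_sequence\<close> and the estimate of the
  matrix coefficients.\<close>

lemma summable_overlap_defect:
  assumes m: "\<And>i. 1 \<le> m i" and sum: "summable (\<lambda>i. 1 / real (m i))"
  shows "summable (\<lambda>i. \<bar>1 - overlap (cube (m i)) x\<bar>)"
proof (rule summable_comparison_test'[where N = 0])
  show "summable (\<lambda>i. l1_norm x * (1 / real (m i)))"
    by (rule summable_mult[OF sum])
  fix i
  have "\<bar>1 - overlap (cube (m i)) x\<bar> \<le> l1_norm x / (real (m i) + 1)"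
    by (rule abs_1_minus_overlap_cube_le)
  also have "\<dots> \<le> l1_norm x / real (m i)"
    using m[of i] by (intro divide_left_mono l1_norm_nonneg) auto
  finally show "norm \<bar>1 - overlap (cube (m i)) x\<bar> \<le> l1_norm x * (1 / real (m i))"
    by simp
qed

lemma sigmaF_sequence_cube_iff:
  assumes m: "\<And>i. 1 \<le> m i"
  shows "sigmaF_sequence (\<lambda>i. cube (m i) :: (int ^ 'n) set) \<longleftrightarrow> summable (\<lambda>i. 1 / real (m i))"
proof
  assume "sigmaF_sequence (\<lambda>i. cube (m i) :: (int ^ 'n) set)"
  then have "summable (\<lambda>i. \<bar>1 - overlap (cube (m i)) (axis undefined 1 :: int ^ 'n)\<bar>)"
    by (simp add: sigmaF_sequence_def)
  \<comment> \<open>The factor 2 suffices because \<open>m i + 1 \<le> 2 * m i\<close> for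
    \<open>m i \<ge> 1\<close>.\<close>
  then have "summable (\<lambda>i. 2 * (1 / (real (m i) + 1)))"
    unfolding overlap_cube_axis by (intro summable_mult) simp
  then show "summable (\<lambda>i. 1 / real (m i))"
  proof (rule summable_comparison_test'[where N = 0])
    fix i
    show "norm (1 / real (m i)) \<le> 2 * (1 / (real (m i) + 1))"
      using m[of i] by (simp add: field_simps)
  qed
next
  assume "summable (\<lambda>i. 1 / real (m i))"
  then show "sigmaF_sequence (\<lambda>i. cube (m i) :: (int ^ 'n) set)"
    by (simp add: sigmaF_sequence_def finite_cube cube_nonempty summable_overlap_defect[of m, OF m])
qed

section \<open>Matrix coefficients of normalized indicators\<close>

definition normalized_indicator :: "'a set \<Rightarrow> 'a \<Rightarrow> complex" where
  "normalized_indicator F = (\<lambda>x. complex_of_real (1 / sqrt (real (card F)) * indicator F x))"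

lemma
  assumes "finite F" "F \<noteq> {}"
  shows square_summable_normalized_indicator: "square_summable (normalized_indicator F)"
    and l2_norm_normalized_indicator: "l2_norm (normalized_indicator F) = 1"
proof -
  have pos: "0 < card F"
    using assms by (simp add: card_gt_0_iff)
  have sq: "(cmod (normalized_indicator F x))\<^sup>2 = (if x \<in> F then 1 / real (card F) else 0)" for x
    by (simp add: normalized_indicator_def norm_divide power_divide indicator_def)
  have "((\<lambda>x. (cmod (normalized_indicator F x))\<^sup>2) has_sum 1) UNIV"
    unfolding sq using assms pos
    by (intro has_sum_finite_neutralI[of F]) auto
  then show "square_summable (normalized_indicator F)" "l2_norm (normalized_indicator F) = 1"
    by (auto simp: square_summable_def l2_norm_def summable_on_def infsumI)
qed

text \<open>Only points of \<open>F\<close> that also lie in its translate contribute, each with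
  weight \<open>1 / card F\<close>.\<close>

lemma l2_inner_regular_rep_normalized_indicator:
  assumes F: "finite F"
  shows "l2_inner (regular_rep u x (normalized_indicator F)) (normalized_indicator F)
    = (\<Sum>y\<in>F \<inter> (+) x ` F. u (- y) x) / of_nat (card F)"
proof -
  have mem: "y \<in> (+) x ` F \<longleftrightarrow> y - x \<in> F" for y
    by (auto intro: image_eqI[of _ _ "y - x"])
  have "complex_of_real (sqrt (real (card F))) * complex_of_real (sqrt (real (card F))) = of_nat (card F)"
    unfolding of_real_mult[symmetric] by simp
  then have "regular_rep u x (normalized_indicator F) y * cnj (normalized_indicator F y)
      = (if y \<in> F \<inter> (+) x ` F then u (- y) x / of_nat (card F) else 0)" for y
    by (auto simp: regular_rep_def normalized_indicator_def mem indicator_def)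
  then have "l2_inner (regular_rep u x (normalized_indicator F)) (normalized_indicator F)
      = (\<Sum>\<^sub>\<infinity>y. if y \<in> F \<inter> (+) x ` F then u (- y) x / of_nat (card F) else 0)"
    by (simp add: l2_inner_def)
  also have "\<dots> = (\<Sum>y\<in>F \<inter> (+) x ` F. u (- y) x / of_nat (card F))"
    using F by (intro infsumI has_sum_finite_neutralI[of "F \<inter> (+) x ` F"]) auto
  finally show ?thesis
    by (simp add: sum_divide_distrib)
qed

text \<open>The defect splits into the missing part of the overlap and the deviation of the phases
  from 1 on the overlap. Points of the cube have \<open>l1_norm\<close> at most the dimension times
  \<open>m\<close>, which produces the factor \<open>m * max_entry A\<close>.\<close>

lemma coefficient_cube_le:
  fixes x :: "int ^ 'n"
  shows "cmod (1 - l2_inner (regular_rep (u_mat A) x (normalized_indicator (cube m))) (normalized_indicator (cube m)))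
    \<le> \<bar>1 - overlap (cube m) x\<bar> + real CARD('n) * l1_norm x * (real m * max_entry A)"
proof -
  let ?I = "cube m \<inter> (+) x ` cube m" and ?c = "real (card (cube m :: (int ^ 'n) set))"
  have c: "0 < ?c"
    using card_cube_pos by simp
  have bound: "cmod (1 - u_mat A (- y) x) \<le> real CARD('n) * l1_norm x * (real m * max_entry A)" if "y \<in> ?I" for y
  proof -
    have "l1_norm (- y) \<le> (\<Sum>j\<in>(UNIV :: 'n set). real m)"
      unfolding l1_norm_def
    proof (rule sum_mono)
      fix j
      have "0 \<le> y $ j" "y $ j \<le> int m"
        using that by (simp_all add: cube_def)
      then show "\<bar>real_of_int ((- y) $ j)\<bar> \<le> real m"
        by simp
    qed
    then have "max_entry A * l1_norm (- y) * l1_norm x \<le> max_entry A * (real CARD('n) * real m) * l1_norm x"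
      by (intro mult_left_mono mult_right_mono max_entry_nonneg l1_norm_nonneg) simp
    then show ?thesis
      using cmod_u_mat_minus_1_le[of A "- y" x] by (simp add: mult_ac)
  qed
  have "1 - l2_inner (regular_rep (u_mat A) x (normalized_indicator (cube m))) (normalized_indicator (cube m))
      = complex_of_real (1 - overlap (cube m) x) + (\<Sum>y\<in>?I. 1 - u_mat A (- y) x) / of_nat (card (cube m :: (int ^ 'n) set))"
    by (simp add: l2_inner_regular_rep_normalized_indicator finite_cube overlap_def sum_subtractf diff_divide_distrib)
  also have "cmod \<dots> \<le> \<bar>1 - overlap (cube m) x\<bar> + cmod (\<Sum>y\<in>?I. 1 - u_mat A (- y) x) / ?c"
    by (rule order_trans[OF norm_triangle_ineq]) (simp only: norm_of_real norm_divide norm_of_nat order_refl)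
  also have "cmod (\<Sum>y\<in>?I. 1 - u_mat A (- y) x)
      \<le> real (card ?I) * (real CARD('n) * l1_norm x * (real m * max_entry A))"
    by (rule order_trans[OF sum_norm_le[OF bound]]) simp_all
  also have "\<dots> \<le> ?c * (real CARD('n) * l1_norm x * (real m * max_entry A))"
    by (intro mult_right_mono) (auto intro!: card_mono finite_cube mult_nonneg_nonneg l1_norm_nonneg max_entry_nonneg)
  finally show ?thesis
    using c by (simp add: divide_right_mono)
qed

theorem proposition4p2:
  fixes A :: "nat \<Rightarrow> real ^ 'n ^ 'n"
    and m :: "nat \<Rightarrow> nat"
    and F :: "nat \<Rightarrow> (int ^ 'n) set"
    and \<phi> :: "nat \<Rightarrow> int ^ 'n \<Rightarrow> complex"
    and u :: "nat \<Rightarrow> int ^ 'n \<Rightarrow> int ^ 'n \<Rightarrow> complex"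
  assumes A_entries: "\<And>i k l. A i $ k $ l \<in> {- pi <.. pi}"
    and m_pos: "\<And>i. m i \<ge> 1"
    and F_def: "\<And>i. F i = {x. \<forall>j. 0 \<le> x $ j \<and> x $ j \<le> int (m i)}"
    and phi_def: "\<And>i. \<phi> i = (\<lambda>x. complex_of_real (1 / sqrt (real (card (F i))) * indicator (F i) x))"
    and u_def: "\<And>i. u i = u_mat (A i)"
  shows "(F_sequence F \<longleftrightarrow> filterlim m at_top sequentially)
    \<and> (sigmaF_sequence F \<longleftrightarrow> summable (\<lambda>i. 1 / real (m i)))
    \<and> ((\<forall>x y. infprod_exists (\<lambda>i. u i x y)) \<longleftrightarrow> summable (\<lambda>i. max_entry (A i)))
    \<and> (summable (\<lambda>i. 1 / real (m i)) \<and> summable (\<lambda>i. real (m i) * max_entry (A i)) \<longrightarrow>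
        (\<forall>x. tensor_op_exists \<phi> (\<lambda>i. regular_rep (u i) x))
      \<and> (\<forall>x y. infprod_exists (\<lambda>i. u i x y))
      \<and> projective_unitary_rep (inf_tensor \<phi>)
          (\<lambda>x. tensor_op \<phi> (\<lambda>i. regular_rep (u i) x))
          (\<lambda>x y. infprod (\<lambda>i. u i x y)))"
proof -
  have F: "F = (\<lambda>i. cube (m i))"
    by (simp add: fun_eq_iff F_def cube_def)
  have \<phi>: "\<phi> = (\<lambda>i. normalized_indicator (cube (m i)))"
    unfolding normalized_indicator_def by (rule ext) (simp only: phi_def F)
  have u: "u = (\<lambda>i. u_mat (A i))"
    by (simp add: fun_eq_iff u_def)
  have prod_iff: "(\<forall>x y. infprod_exists (\<lambda>i. u i x y)) \<longleftrightarrow> summable (\<lambda>i. max_entry (A i))"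
    unfolding u by (rule infprod_exists_u_mat_iff[OF A_entries])
  have "(\<forall>x. tensor_op_exists \<phi> (\<lambda>i. regular_rep (u i) x))
      \<and> (\<forall>x y. infprod_exists (\<lambda>i. u i x y))
      \<and> projective_unitary_rep (inf_tensor \<phi>)
          (\<lambda>x. tensor_op \<phi> (\<lambda>i. regular_rep (u i) x))
          (\<lambda>x y. infprod (\<lambda>i. u i x y))"
    if m: "summable (\<lambda>i. 1 / real (m i))" and mA: "summable (\<lambda>i. real (m i) * max_entry (A i))"
  proof -
    \<comment> \<open>As every \<open>m i\<close> is at least 1, the weighted series dominates this
      one; existence of the products follows.\<close>
    have "summable (\<lambda>i. max_entry (A i))"
      using mA
    proof (rule summable_comparison_test'[where N = 0])
      fix i
      have "1 * max_entry (A i) \<le> real (m i) * max_entry (A i)"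
        using m_pos[of i] by (intro mult_right_mono max_entry_nonneg) simp
      then show "norm (max_entry (A i)) \<le> real (m i) * max_entry (A i)"
        by (simp add: max_entry_nonneg)
    qed
    then have prod: "\<forall>x y. infprod_exists (\<lambda>i. u i x y)"
      using prod_iff by blast
    interpret cocycle_system u \<phi>
    proof
      fix i and x :: "int ^ 'n"
      show "u i \<in> cocycles"
        by (simp add: u u_mat_cocycle)
      show "square_summable (\<phi> i)" "l2_norm (\<phi> i) = 1"
        by (simp_all add: \<phi> square_summable_normalized_indicator l2_norm_normalized_indicator
            finite_cube cube_nonempty)
      \<comment> \<open>This is the bound of \<open>coefficient_cube_le\<close>: the first
        hypothesis sums the overlap defects, the second the phase deviations.\<close>
      have "summable (\<lambda>i. \<bar>1 - overlap (cube (m i)) x\<bar> + real CARD('n) * l1_norm x * (real (m i) * max_entry (A i)))"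
        by (intro summable_add summable_overlap_defect m_pos m summable_mult mA)
      then show "summable (\<lambda>i. cmod (1 - l2_inner (regular_rep (u i) x (\<phi> i)) (\<phi> i)))"
        by (rule summable_comparison_test'[where N = 0]) (simp add: u \<phi> coefficient_cube_le)
    qed
    show ?thesis
      using prod tensor_op_exists_regular_rep projective_unitary_rep_tensor_op by blast
  qed
  moreover have "F_sequence F \<longleftrightarrow> filterlim m at_top sequentially"
    unfolding F by (rule F_sequence_cube_iff)
  moreover have "sigmaF_sequence F \<longleftrightarrow> summable (\<lambda>i. 1 / real (m i))"
    unfolding F by (rule sigmaF_sequence_cube_iff[OF m_pos])
  ultimately show ?thesis
    using prod_iff by blast
qed

end
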